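(* Let $X$ be a finite set with $|X|=n\ge 2$, and let $F_X$ be the free group over $X$. Then $$\mathscr G(F_X)=\operatorname{Aut}(F_X)\qquad\text{and}\qquad \mathscr C(F_X)=\operatorname{Aut}^{\pm}(F_X)=\langle\iota\rangle\times\operatorname{Aut}(F_X)\ \text{(internal direct product)},$$ where $\iota:F_X\to F_X$ is the inversion map $w\mapsto w^{-1}$.
   Context: For a semigroup (in particular a group) $S$: $\operatorname{Aut}(S)$ is the set of automorphisms of $S$; $\operatorname{Aut}^-(S)$ is the set of anti-automorphisms, i.e. bijections $\alpha:S\to S$ with $\alpha(xy)=\alpha(y)\alpha(x)$ for all $x,y$; $\operatorname{Aut}^{\pm}(S)=\operatorname{Aut}(S)\cup\operatorname{Aut}^-(S)$, a group under composition. $I(S)=\{\alpha\in\operatorname{Aut}^-(S):\alpha^2=\mathrm{id}_S\neq\alpha\}$ is the set of involutions of $S$ and $\mathscr C(S)=\langle I(S)\rangle\le\operatorname{Aut}^{\pm}(S)$. Also $J(S)=\{\alpha\in\operatorname{Aut}(S):\alpha^2=\mathrm{id}_S\}$ and $\mathscr G(S)=\langle J(S)\rangle\le\operatorname{Aut}(S)$. *)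

theory Defs
  imports "HOL-Algebra.Bij" "HOL-Algebra.Elementary_Groups"
begin

section \<open>Automorphisms, anti-automorphisms and involutions of a semigroup\<close>

text \<open>Only the carrier and the multiplication of the record matter in this section. As in
  \<^theory>\<open>HOL-Algebra.Bij\<close>, a bijection of the carrier is an extensional function, so that the
  identity of S is the restricted identity and composition is \<^const>\<open>compose\<close>.\<close>

definition anti_auto :: "('a, 'b) monoid_scheme \<Rightarrow> ('a \<Rightarrow> 'a) set" where
  "anti_auto S = {\<alpha> \<in> Bij (carrier S).
     \<forall>x \<in> carrier S. \<forall>y \<in> carrier S. \<alpha> (x \<otimes>\<^bsub>S\<^esub> y) = \<alpha> y \<otimes>\<^bsub>S\<^esub> \<alpha> x}"

definition auto_pm :: "('a, 'b) monoid_scheme \<Rightarrow> ('a \<Rightarrow> 'a) set" where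
  "auto_pm S = auto S \<union> anti_auto S"

definition AutoPMGroup :: "('a, 'b) monoid_scheme \<Rightarrow> ('a \<Rightarrow> 'a) monoid" where
  "AutoPMGroup S = BijGroup (carrier S) \<lparr>carrier := auto_pm S\<rparr>"

definition involutions :: "('a, 'b) monoid_scheme \<Rightarrow> ('a \<Rightarrow> 'a) set" where
  "involutions S = {\<alpha> \<in> anti_auto S.
     compose (carrier S) \<alpha> \<alpha> = (\<lambda>x \<in> carrier S. x) \<and> \<alpha> \<noteq> (\<lambda>x \<in> carrier S. x)}"

definition involution_group :: "('a, 'b) monoid_scheme \<Rightarrow> ('a \<Rightarrow> 'a) set" where
  "involution_group S = generate (AutoPMGroup S) (involutions S)"

text \<open>In contrast to \<^const>\<open>involutions\<close>, the identity is not excluded here.\<close>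

definition square_id_autos :: "('a, 'b) monoid_scheme \<Rightarrow> ('a \<Rightarrow> 'a) set" where
  "square_id_autos S = {\<alpha> \<in> auto S. compose (carrier S) \<alpha> \<alpha> = (\<lambda>x \<in> carrier S. x)}"

definition square_id_auto_group :: "('a, 'b) monoid_scheme \<Rightarrow> ('a \<Rightarrow> 'a) set" where
  "square_id_auto_group S = generate (AutoGroup S) (square_id_autos S)"

definition inversion :: "('a, 'b) monoid_scheme \<Rightarrow> 'a \<Rightarrow> 'a" where
  "inversion G = (\<lambda>w \<in> carrier G. inv\<^bsub>G\<^esub> w)"


section \<open>Internal direct products\<close>

text \<open>Normality of a subgroup entails that the ambient structure is a group.\<close>

definition internal_direct_product ::
    "('a, 'b) monoid_scheme \<Rightarrow> 'a set \<Rightarrow> 'a set \<Rightarrow> bool" where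
  "internal_direct_product G H K \<longleftrightarrow>
     H \<lhd> G \<and> K \<lhd> G \<and> H \<inter> K = {\<one>\<^bsub>G\<^esub>} \<and> H <#>\<^bsub>G\<^esub> K = carrier G"


section \<open>Free groups\<close>

text \<open>The free group over X consists of the reduced words in the letters x (encoded as
  \<open>(False, x)\<close>) and their formal inverses (encoded as \<open>(True, x)\<close>).\<close>

type_synonym 'a letter = "bool \<times> 'a"

definition inv_letter :: "'a letter \<Rightarrow> 'a letter" where
  "inv_letter a = (\<not> fst a, snd a)"

definition reduced :: "'a letter list \<Rightarrow> bool" where
  "reduced = successively (\<lambda>a b. b \<noteq> inv_letter a)"

fun push :: "'a letter \<Rightarrow> 'a letter list \<Rightarrow> 'a letter list" where
  "push a [] = [a]"
| "push a (b # w) = (if b = inv_letter a then w else a # b # w)"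

definition FreeGroup :: "'a set \<Rightarrow> 'a letter list monoid" where
  "FreeGroup X =
     \<lparr>carrier = {w. reduced w \<and> set w \<subseteq> UNIV \<times> X},
      mult = \<lambda>u v. foldr push u v,
      one = []\<rparr>"

text \<open>This is a group in which inversion is the formal one, and it has the universal property
  of the free group over X.\<close>

lemma inv_letter_inv_letter [simp]: "inv_letter (inv_letter a) = a"
  by (simp add: inv_letter_def)

lemma inv_letter_neq [simp]: "inv_letter a \<noteq> a" "a \<noteq> inv_letter a"
  by (auto simp: inv_letter_def prod_eq_iff)

lemma inv_letter_eq_iff: "a = inv_letter b \<longleftrightarrow> b = inv_letter a"
  by auto

lemma snd_inv_letter [simp]: "snd (inv_letter a) = snd a"
  by (simp add: inv_letter_def)

lemma reduced_Nil [simp]: "reduced []"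
  by (simp add: reduced_def)

lemma reduced_ConsD: "reduced (a # w) \<Longrightarrow> reduced w"
  by (cases w) (auto simp: reduced_def)

lemma push_reduced_Cons: "reduced (a # w) \<Longrightarrow> push a w = a # w"
  by (cases w) (auto simp: reduced_def)

lemma reduced_push: "reduced w \<Longrightarrow> reduced (push a w)"
  by (cases w) (auto simp: reduced_def dest: reduced_ConsD[unfolded reduced_def])

lemma reduced_mult: "reduced v \<Longrightarrow> reduced (foldr push u v)"
  by (induction u) (auto intro: reduced_push)

lemma set_push: "set (push a w) \<subseteq> insert a (set w)"
  by (cases w) auto

lemma set_mult_words: "set (foldr push u v) \<subseteq> set u \<union> set v"
  by (induction u) (use set_push in fastforce)+

lemma push_inv_push: "reduced w \<Longrightarrow> push (inv_letter a) (push a w) = w"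
proof (cases w)
  case (Cons b v)
  assume "reduced w"
  then have "reduced (b # v)" using Cons by simp
  from push_reduced_Cons[OF this] show ?thesis
    using Cons by auto
qed simp

lemma mult_push: "reduced w \<Longrightarrow> foldr push (push a u) w = push a (foldr push u w)"
proof (cases u)
  case (Cons b v)
  assume "reduced w"
  then show ?thesis
    using Cons push_inv_push[OF reduced_mult, of w "inv_letter a" v] by auto
qed simp

lemma mult_assoc_words:
  "reduced w \<Longrightarrow> foldr push (foldr push u v) w = foldr push u (foldr push v w)"
  by (induction u) (auto simp: mult_push)

lemma mult_Nil: "reduced w \<Longrightarrow> foldr push w [] = w"
proof (induction w)
  case (Cons a w)
  then show ?case using push_reduced_Cons[OF Cons.prems] reduced_ConsD[OF Cons.prems] by simp
qed simp

lemma reduced_rev_inv: "reduced w \<Longrightarrow> reduced (rev (map inv_letter w))"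
  unfolding reduced_def
  by (auto simp: successively_rev successively_map elim!: successively_mono)

lemma rev_inv_mult: "foldr push (rev (map inv_letter w)) w = []"
  by (induction w) auto

lemma rev_inv_in_carrier:
  "w \<in> carrier (FreeGroup X) \<Longrightarrow> rev (map inv_letter w) \<in> carrier (FreeGroup X)"
  by (auto simp: FreeGroup_def reduced_rev_inv inv_letter_def)

lemma group_FreeGroup: "group (FreeGroup X)"
proof (rule groupI)
  fix x assume "x \<in> carrier (FreeGroup X)"
  then show "\<exists>y \<in> carrier (FreeGroup X). y \<otimes>\<^bsub>FreeGroup X\<^esub> x = \<one>\<^bsub>FreeGroup X\<^esub>"
    by (intro bexI[OF _ rev_inv_in_carrier]) (auto simp: FreeGroup_def rev_inv_mult)
next
  fix x y assume "x \<in> carrier (FreeGroup X)" "y \<in> carrier (FreeGroup X)"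
  then show "x \<otimes>\<^bsub>FreeGroup X\<^esub> y \<in> carrier (FreeGroup X)"
    using set_mult_words[of x y] by (auto simp: FreeGroup_def reduced_mult)
qed (auto simp: FreeGroup_def mult_assoc_words)

lemma inv_FreeGroup:
  assumes "w \<in> carrier (FreeGroup X)"
  shows "inv\<^bsub>FreeGroup X\<^esub> w = rev (map inv_letter w)"
  by (rule group.inv_equality[OF group_FreeGroup _ assms rev_inv_in_carrier[OF assms]])
    (simp add: FreeGroup_def rev_inv_mult)

lemma generator_in_FreeGroup: "x \<in> X \<Longrightarrow> [(False, x)] \<in> carrier (FreeGroup X)"
  by (simp add: FreeGroup_def reduced_def)

theorem FreeGroup_universal:
  assumes "group H" and f: "f \<in> X \<rightarrow> carrier H"
  shows "\<exists>!h. h \<in> extensional (carrier (FreeGroup X)) \<and> h \<in> hom (FreeGroup X) H \<and>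
           (\<forall>x \<in> X. h [(False, x)] = f x)"
proof -
  interpret H: group H by fact
  interpret F: group "FreeGroup X" by (rule group_FreeGroup)
  define l where "l = (\<lambda>a. if fst a then inv\<^bsub>H\<^esub> f (snd a) else f (snd a))"
  define e where "e = (\<lambda>w. foldr (\<lambda>a r. l a \<otimes>\<^bsub>H\<^esub> r) w \<one>\<^bsub>H\<^esub>)"
  have l: "l a \<in> carrier H" if "snd a \<in> X" for a
    using that f by (auto simp: l_def)
  have e: "e w \<in> carrier H" if "set w \<subseteq> UNIV \<times> X" for w
    using that l by (induction w) (auto simp: e_def)
  have linv: "l a \<otimes>\<^bsub>H\<^esub> (l (inv_letter a) \<otimes>\<^bsub>H\<^esub> z) = z" if "snd a \<in> X" "z \<in> carrier H" for a z
  proof -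
    have "f (snd a) \<in> carrier H" using that f by auto
    then show ?thesis
      using that by (auto simp: l_def inv_letter_def H.m_assoc[symmetric])
  qed
  have push: "e (push a w) = l a \<otimes>\<^bsub>H\<^esub> e w" if "snd a \<in> X" "set w \<subseteq> UNIV \<times> X" for a w
  proof (cases w)
    case Nil
    then show ?thesis by (simp add: e_def)
  next
    case (Cons b v)
    then have "e v \<in> carrier H" using that e by auto
    then show ?thesis using Cons linv[OF that(1)] by (auto simp: e_def)
  qed
  have mult: "e (foldr push u v) = e u \<otimes>\<^bsub>H\<^esub> e v"
    if "set u \<subseteq> UNIV \<times> X" "set v \<subseteq> UNIV \<times> X" for u v
    using that(1)
  proof (induction u)
    case Nil
    then show ?case using e[OF that(2)] by (simp add: e_def)
  next
    case (Cons a u)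
    then have a: "snd a \<in> X" and u: "set u \<subseteq> UNIV \<times> X" by auto
    have "set (foldr push u v) \<subseteq> UNIV \<times> X"
      using set_mult_words[of u v] u that(2) by blast
    then have "e (foldr push (a # u) v) = l a \<otimes>\<^bsub>H\<^esub> (e u \<otimes>\<^bsub>H\<^esub> e v)"
      using push[OF a] Cons.IH[OF u] by simp
    then show ?case
      using l[OF a] e[OF u] e[OF that(2)] by (simp add: e_def H.m_assoc)
  qed
  define h where "h = restrict e (carrier (FreeGroup X))"
  have hom: "h \<in> hom (FreeGroup X) H"
  proof (rule homI)
    fix x assume "x \<in> carrier (FreeGroup X)"
    then show "h x \<in> carrier H" using e by (simp add: h_def FreeGroup_def)
  next
    fix x y assume xy: "x \<in> carrier (FreeGroup X)" "y \<in> carrier (FreeGroup X)"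
    then have "x \<otimes>\<^bsub>FreeGroup X\<^esub> y \<in> carrier (FreeGroup X)" by simp
    moreover have "e (x \<otimes>\<^bsub>FreeGroup X\<^esub> y) = e x \<otimes>\<^bsub>H\<^esub> e y"
      using xy mult by (simp add: FreeGroup_def)
    ultimately show "h (x \<otimes>\<^bsub>FreeGroup X\<^esub> y) = h x \<otimes>\<^bsub>H\<^esub> h y"
      using xy by (simp add: h_def)
  qed
  have gen: "h [(False, x)] = f x" if "x \<in> X" for x
  proof -
    have "f x \<in> carrier H" using that f by auto
    then show ?thesis
      using generator_in_FreeGroup[OF that] by (simp add: h_def e_def l_def)
  qed
  have uniq: "g w = e w"
    if g: "g \<in> hom (FreeGroup X) H" "\<forall>x \<in> X. g [(False, x)] = f x"
      and "w \<in> carrier (FreeGroup X)" for g w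
    using that(3)
  proof (induction w)
    case Nil
    have "g \<one>\<^bsub>FreeGroup X\<^esub> = \<one>\<^bsub>H\<^esub>"
      using hom_one[OF g(1) F.is_group H.is_group] .
    then show ?case by (simp add: e_def FreeGroup_def)
  next
    case (Cons a w)
    obtain s x where a: "a = (s, x)" by (cases a)
    have x: "x \<in> X" and w: "w \<in> carrier (FreeGroup X)" and red: "reduced (a # w)"
      using Cons.prems a by (auto simp: FreeGroup_def dest: reduced_ConsD)
    have aF: "[a] \<in> carrier (FreeGroup X)"
      using x by (simp add: FreeGroup_def reduced_def a)
    have "g [a] = l a"
    proof (cases s)
      case True
      have "[a] = inv\<^bsub>FreeGroup X\<^esub> [(False, x)]"
        using inv_FreeGroup[OF generator_in_FreeGroup[OF x]] True a by (simp add: inv_letter_def)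
      moreover have "group_hom (FreeGroup X) H g"
        using g(1) by unfold_locales
      ultimately have "g [a] = inv\<^bsub>H\<^esub> g [(False, x)]"
        using group_hom.hom_inv[OF _ generator_in_FreeGroup[OF x]] by simp
      then show ?thesis using g(2) x True a by (simp add: l_def)
    next
      case False
      then show ?thesis using g(2) x a by (simp add: l_def)
    qed
    moreover have "a # w = [a] \<otimes>\<^bsub>FreeGroup X\<^esub> w"
      using red by (simp add: FreeGroup_def push_reduced_Cons)
    ultimately have "g (a # w) = l a \<otimes>\<^bsub>H\<^esub> e w"
      using hom_mult[OF g(1) aF w] Cons.IH[OF w] by metis
    then show ?case by (simp add: e_def)
  qed
  show ?thesis
  proof (rule ex1I[of _ h])
    fix g assume "g \<in> extensional (carrier (FreeGroup X)) \<and> g \<in> hom (FreeGroup X) H \<and>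
           (\<forall>x \<in> X. g [(False, x)] = f x)"
    then show "g = h"
      by (intro extensionalityI[of _ "carrier (FreeGroup X)"]) (auto simp: h_def uniq)
  qed (use hom gen in \<open>auto simp: h_def\<close>)
qed

end

theory Submission
  imports Defs
begin

text \<open>Every automorphism \<open>\<phi>\<close> of the free group is a product of involutive ones by Nielsen reduction.
  For letters a, b of different generators, the automorphism that maps a to ab and b to its inverse
  and fixes the other generators is an involution; composing \<open>\<phi>\<close> with it replaces the image u of a
  by uv, where v is the image of b. As long as some factor may be cancelled entirely between its
  neighbours in a product of images of letters, such a replacement decreases the total length or,
  at equal length, the numbers represented by the initial halves of the words and of their inverses,
  in a positional system with the letters as digits. Once no factor is cancelled, \<open>\<phi>\<close> does not
  shorten words, so it permutes the letters and is a product of swaps.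

  The inversion \<open>\<iota>\<close> commutes with all automorphisms and anti-automorphisms, and multiplication by it
  exchanges the two kinds. Hence an involutive automorphism \<open>\<sigma>\<close> is the product of the involutions
  \<open>\<iota>\<close> and \<open>\<iota>\<sigma>\<close>.\<close>


section \<open>Reduced words\<close>

text \<open>Formal inversion of arbitrary words, reduced or not; on the carrier of the free group it
  is the group inverse.\<close>

definition winv :: "'a letter list \<Rightarrow> 'a letter list" where
  "winv w = rev (map inv_letter w)"

lemma winv_Nil [simp]: "winv [] = []"
  by (simp add: winv_def)

lemma winv_append [simp]: "winv (u @ v) = winv v @ winv u"
  by (simp add: winv_def)

lemma length_winv [simp]: "length (winv w) = length w"
  by (simp add: winv_def)

lemma winv_winv [simp]: "winv (winv w) = w"
  by (induction w) (simp_all add: winv_def)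

lemma take_winv: "n \<le> length w \<Longrightarrow> take n (winv w) = winv (drop (length w - n) w)"
  by (simp add: winv_def take_rev drop_map)

lemma drop_winv: "n \<le> length w \<Longrightarrow> drop n (winv w) = winv (take (length w - n) w)"
  by (simp add: winv_def drop_rev take_map)

lemma nth_winv: "i < length w \<Longrightarrow> winv w ! i = inv_letter (w ! (length w - Suc i))"
  by (simp add: winv_def rev_nth)

lemma reduced_append_iff:
  "reduced (u @ v) \<longleftrightarrow>
    reduced u \<and> reduced v \<and> (u = [] \<or> v = [] \<or> hd v \<noteq> inv_letter (last u))"
  by (simp add: reduced_def successively_append_iff)

lemma reduced_singleton [simp]: "reduced [a]"
  by (simp add: reduced_def)

lemma inv_letter_inject [simp]: "inv_letter a = inv_letter b \<longleftrightarrow> a = b"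
  by (metis inv_letter_inv_letter)

lemma reduced_nthD: "reduced w \<Longrightarrow> Suc i < length w \<Longrightarrow> w ! Suc i \<noteq> inv_letter (w ! i)"
  by (simp add: reduced_def successively_conv_nth)

text \<open>The word \<open>p\<close> need not be reduced, since its letters are pushed and removed
  again one at a time.\<close>

lemma mult_winv_cancel: "reduced v \<Longrightarrow> foldr push (winv p) (foldr push p v) = v"
proof (induction p)
  case (Cons a p)
  then show ?case
    using push_inv_push[OF reduced_mult, of v a p] by (simp add: winv_def)
qed simp

lemma mult_reduced_append: "reduced (u @ v) \<Longrightarrow> foldr push u v = u @ v"
proof (induction u)
  case (Cons a u)
  then show ?case
    using push_reduced_Cons[of a "u @ v"] reduced_ConsD[of a "u @ v"] by simp
qed simp

section \<open>Common prefixes and cancellation in products\<close>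

fun lcp :: "'b list \<Rightarrow> 'b list \<Rightarrow> nat" where
  "lcp (a # u) (b # v) = (if a = b then Suc (lcp u v) else 0)"
| "lcp _ _ = 0"

lemma le_lcp_iff: "k \<le> lcp u v \<longleftrightarrow> k \<le> length u \<and> k \<le> length v \<and> take k u = take k v"
  by (induction u v arbitrary: k rule: lcp.induct) (auto simp: take_Cons split: nat.splits)

lemma lcp_commute: "lcp u v = lcp v u"
  by (induction u v rule: lcp.induct) auto

lemma lcp_le: "lcp u v \<le> length u" "lcp u v \<le> length v"
  using le_lcp_iff[of "lcp u v" u v] by auto

lemma take_lcp: "take (lcp u v) u = take (lcp u v) v"
  using le_lcp_iff[of "lcp u v" u v] by auto

lemma lcp_nth: "i < lcp u v \<Longrightarrow> u ! i = v ! i"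
  by (metis nth_take take_lcp)

lemma lcp_nth_neq: "lcp u v < length u \<Longrightarrow> lcp u v < length v \<Longrightarrow> u ! lcp u v \<noteq> v ! lcp u v"
  by (induction u v rule: lcp.induct) auto

text \<open>At position \<open>lcp u v\<close> the word \<open>u\<close> ends or departs from
  \<open>v\<close>, while \<open>v\<close> and \<open>w\<close> still agree there; so
  \<open>u\<close> parts from \<open>w\<close> at the same place.\<close>

lemma lcp_ultrametric: "lcp u v < lcp v w \<Longrightarrow> lcp u w = lcp u v"
proof (rule antisym)
  assume less: "lcp u v < lcp v w"
  show "lcp u v \<le> lcp u w"
    unfolding le_lcp_iff
    using less le_lcp_iff[of "lcp u v" u v] le_lcp_iff[of "lcp u v" v w] by simp
  show "lcp u w \<le> lcp u v"
  proof (rule ccontr)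
    assume "\<not> ?thesis"
    then have "Suc (lcp u v) \<le> lcp u w" "Suc (lcp u v) \<le> lcp v w"
      using less by auto
    then have "Suc (lcp u v) \<le> lcp u v"
      unfolding le_lcp_iff[of "Suc (lcp u v)"] by simp
    then show False by simp
  qed
qed

text \<open>A suffix of \<open>u\<close> cancels against a prefix of \<open>v\<close> when the two
  are formally inverse. For reduced words this counts the letters that each factor loses in the
  product.\<close>

definition cancellation :: "'a letter list \<Rightarrow> 'a letter list \<Rightarrow> nat" where
  "cancellation u v = lcp (winv u) v"

lemma cancellation_le: "cancellation u v \<le> length u" "cancellation u v \<le> length v"
  using lcp_le[of "winv u" v] by (simp_all add: cancellation_def)

lemma cancellation_winv: "cancellation (winv v) (winv u) = cancellation u v"
  by (simp add: cancellation_def lcp_commute)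

lemma cancelled_suffix:
  "drop (length u - cancellation u v) u = winv (take (cancellation u v) v)"
  by (metis cancellation_def cancellation_le(1) take_lcp take_winv winv_winv)

text \<open>Write \<open>u\<close> as \<open>a @ winv p\<close> and \<open>v\<close> as
  \<open>p @ b\<close> with \<open>p\<close> the cancelled prefix. By maximality of
  \<open>p\<close>, the letters that meet between \<open>a\<close> and \<open>b\<close> are not
  inverse, so \<open>a @ b\<close> is reduced.\<close>

lemma mult_cancellation:
  assumes u: "reduced u" and v: "reduced v"
  shows "foldr push u v =
    take (length u - cancellation u v) u @ drop (cancellation u v) v"
proof -
  define c where "c = cancellation u v"
  define a b p where "a = take (length u - c) u" and "b = drop c v" and "p = take c v"
  have le: "c \<le> length u" "c \<le> length v"
    using cancellation_le[of u v] by (simp_all add: c_def)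
  have ua: "u = a @ winv p"
    unfolding a_def p_def c_def using cancelled_suffix[of u v] by (metis append_take_drop_id)
  have vb: "v = p @ b" by (simp add: p_def b_def)
  have red: "reduced a" "reduced b" "reduced (p @ b)"
    using u v ua vb by (auto simp: reduced_append_iff)
  have "hd b \<noteq> inv_letter (last a)" if "a \<noteq> []" "b \<noteq> []"
  proof -
    have less: "c < length u" "c < length v"
      using that le unfolding a_def b_def by auto
    then have "winv u ! c \<noteq> v ! c"
      using lcp_nth_neq[of "winv u" v] by (simp add: c_def cancellation_def)
    moreover have "winv u ! c = inv_letter (u ! (length u - Suc c))"
      using less by (simp add: nth_winv)
    moreover have "last a = u ! (length u - Suc c)"
      using less that unfolding a_def by (simp add: last_conv_nth)
    moreover have "hd b = v ! c"
      using less by (simp add: b_def hd_drop_conv_nth)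
    ultimately show ?thesis by simp
  qed
  then have "reduced (a @ b)"
    using red by (auto simp: reduced_append_iff)
  then have "foldr push a b = a @ b"
    by (rule mult_reduced_append)
  moreover have "foldr push (winv p) (p @ b) = b"
    using mult_winv_cancel[OF red(2), of p] mult_reduced_append[OF red(3)] by simp
  ultimately show ?thesis
    using ua vb unfolding a_def b_def c_def by (metis foldr_append o_apply)
qed

lemma length_mult:
  assumes "reduced u" "reduced v"
  shows "length (foldr push u v) + 2 * cancellation u v = length u + length v"
  using mult_cancellation[OF assms] cancellation_le[of u v] by simp

text \<open>A cancellation of half the word would make its middle letter, or its two middle letters,
  inverse to itself resp. to each other.\<close>

lemma cancellation_self:
  assumes "reduced u" "u \<noteq> []"
  shows "2 * cancellation u u < length u"
proof (rule ccontr)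
  assume "\<not> ?thesis"
  then have c: "length u \<le> 2 * cancellation u u" by simp
  define i where "i = (length u - 1) div 2"
  have n: "length u > 0" using assms(2) by simp
  have i: "i < cancellation u u" "i < length u" using c n unfolding i_def by linarith+
  then have ui: "u ! i = inv_letter (u ! (length u - Suc i))"
    using lcp_nth[of i "winv u" u] by (simp add: cancellation_def nth_winv)
  show False
  proof (cases "even (length u)")
    case True
    then have "length u - Suc i = Suc i" "Suc i < length u"
      using n unfolding i_def by presburger+
    then show False using reduced_nthD[OF assms(1), of i] ui by simp
  next
    case False
    then have "length u - Suc i = i" unfolding i_def by presburger
    then show False using ui by simp
  qed
qed


section \<open>Ranks of words\<close>

definition numeral_value :: "nat \<Rightarrow> ('b \<Rightarrow> nat) \<Rightarrow> 'b list \<Rightarrow> nat" where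
  "numeral_value B d w = foldl (\<lambda>n a. n * B + d a) 0 w"

lemma numeral_value_append:
  "numeral_value B d (u @ v) = numeral_value B d u * B ^ length v + numeral_value B d v"
  by (induction v rule: rev_induct) (simp_all add: numeral_value_def algebra_simps)

text \<open>Reduction modulo \<open>B\<close> recovers the last digit, and induction the others.
  Equal lengths rule out an ambiguity from leading zeros.\<close>

lemma numeral_value_inj:
  assumes "length u = length v" "numeral_value B d u = numeral_value B d v"
    and d: "\<And>a. a \<in> A \<Longrightarrow> d a < B" "inj_on d A" and "set u \<subseteq> A" "set v \<subseteq> A"
  shows "u = v"
  using assms(1,2,5,6)
proof (induction u v rule: rev_induct2)
  case (4 a u b v)
  have eq: "numeral_value B d u * B + d a = numeral_value B d v * B + d b"
    using 4 by (simp add: numeral_value_append) (simp add: numeral_value_def)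
  have lt: "d a < B" "d b < B" using 4 d by auto
  then have "d a = d b"
    using arg_cong[OF eq, of "\<lambda>n. n mod B"] by simp
  moreover from this have "numeral_value B d u = numeral_value B d v"
    using eq lt by simp
  ultimately show ?case
    using 4 d(2) by (auto dest: inj_onD)
qed simp_all

definition half_value :: "nat \<Rightarrow> ('b \<Rightarrow> nat) \<Rightarrow> 'b list \<Rightarrow> nat" where
  "half_value B d w = numeral_value B d (take ((length w + 1) div 2) w)"

text \<open>The word and its inverse enter symmetrically, so that replacing a generator by its
  inverse does not affect the rank of its image.\<close>

definition rank :: "nat \<Rightarrow> ('a letter \<Rightarrow> nat) \<Rightarrow> 'a letter list \<Rightarrow> nat" where
  "rank B d w = half_value B d w + half_value B d (winv w)"

lemma rank_winv [simp]: "rank B d (winv w) = rank B d w"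
  by (simp add: rank_def)

text \<open>With \<open>v\<close> split into halves \<open>p\<close> and \<open>q\<close>, the
  product replaces the suffix \<open>winv p\<close> of \<open>u\<close> by \<open>q\<close>. This
  leaves the initial half of \<open>u\<close> alone; in the inverse the prefix \<open>p\<close>
  becomes \<open>winv q\<close>, whose value is smaller.\<close>

lemma rank_decreases:
  assumes B: "B > 0" and u: "reduced u" and v: "reduced v"
    and c: "2 * cancellation u v = length v" "length v \<le> length u"
    and less: "numeral_value B d (winv (drop (cancellation u v) v))
      < numeral_value B d (take (cancellation u v) v)"
  shows "length (foldr push u v) = length u" "rank B d (foldr push u v) < rank B d u"
proof -
  define k where "k = cancellation u v"
  define a p q where "a = take (length u - k) u" and "p = take k v" and "q = drop k v"
  have ua: "u = a @ winv p"
    unfolding a_def p_def k_def using cancelled_suffix[of u v] by (metis append_take_drop_id)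
  have uv: "foldr push u v = a @ q"
    using mult_cancellation[OF u v] by (simp add: a_def q_def k_def)
  have len: "length p = k" "length q = k" "k \<le> length a"
    using c cancellation_le[of u v] by (auto simp: p_def q_def a_def k_def)
  show len_uv: "length (foldr push u v) = length u"
    using ua uv len by simp
  define h where "h = (length u + 1) div 2"
  have "length u = length a + k"
    using ua len by simp
  then have h: "h \<le> length a" "k \<le> h"
    using len(3) unfolding h_def by linarith+
  have "half_value B d (foldr push u v) = half_value B d u"
    unfolding half_value_def len_uv h_def[symmetric] using ua uv h by simp
  moreover have "half_value B d (winv (foldr push u v)) < half_value B d (winv u)"
  proof -
    have less': "numeral_value B d (winv q) < numeral_value B d p"
      using less by (simp add: p_def q_def k_def)
    \<comment> \<open>The rest of the initial half, which both inverses share.\<close>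
    define t where "t = take (h - k) (winv a)"
    have "take h (winv (foldr push u v)) = winv q @ t" "take h (winv u) = p @ t"
      using ua uv len h by (simp_all add: t_def)
    moreover have "numeral_value B d (winv q @ t) < numeral_value B d (p @ t)"
      using less' B by (simp add: numeral_value_append)
    ultimately show ?thesis
      unfolding half_value_def length_winv len_uv h_def[symmetric] by simp
  qed
  ultimately show "rank B d (foldr push u v) < rank B d u"
    by (simp add: rank_def)
qed


section \<open>Endomorphisms of free groups\<close>

lemma mult_FreeGroup [simp]: "u \<otimes>\<^bsub>FreeGroup X\<^esub> v = foldr push u v"
  by (simp add: FreeGroup_def)

lemma one_FreeGroup [simp]: "\<one>\<^bsub>FreeGroup X\<^esub> = []"
  by (simp add: FreeGroup_def)

lemma mem_FreeGroup: "w \<in> carrier (FreeGroup X) \<longleftrightarrow> reduced w \<and> snd ` set w \<subseteq> X"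
  by (auto simp: FreeGroup_def)

lemma inv_FreeGroup_winv: "w \<in> carrier (FreeGroup X) \<Longrightarrow> inv\<^bsub>FreeGroup X\<^esub> w = winv w"
  by (simp add: inv_FreeGroup winv_def)

lemma winv_mem_FreeGroup: "w \<in> carrier (FreeGroup X) \<Longrightarrow> winv w \<in> carrier (FreeGroup X)"
  using rev_inv_in_carrier by (simp add: winv_def)

lemma letter_mem_FreeGroup [simp]: "[a] \<in> carrier (FreeGroup X) \<longleftrightarrow> snd a \<in> X"
  by (auto simp: mem_FreeGroup reduced_def)

lemma inv_letter_cases: "snd a = snd b \<longleftrightarrow> a = b \<or> a = inv_letter b"
  by (auto simp: inv_letter_def prod_eq_iff)

lemma hom_FreeGroup_mem:
  "h \<in> hom (FreeGroup X) (FreeGroup X) \<Longrightarrow> w \<in> carrier (FreeGroup X) \<Longrightarrow>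
    h w \<in> carrier (FreeGroup X)"
  by (auto simp: hom_def)

lemma hom_FreeGroup_mult:
  "h \<in> hom (FreeGroup X) (FreeGroup X) \<Longrightarrow> u \<in> carrier (FreeGroup X) \<Longrightarrow>
    v \<in> carrier (FreeGroup X) \<Longrightarrow> h (foldr push u v) = foldr push (h u) (h v)"
  by (auto simp: hom_def)

lemma hom_FreeGroup_winv:
  assumes "h \<in> hom (FreeGroup X) (FreeGroup X)" "w \<in> carrier (FreeGroup X)"
  shows "h (winv w) = winv (h w)"
proof -
  interpret group_hom "FreeGroup X" "FreeGroup X" h
    using assms(1) group_FreeGroup by (simp add: group_hom_def group_hom_axioms_def)
  show ?thesis
    using hom_inv[OF assms(2)] assms by (simp add: inv_FreeGroup_winv hom_FreeGroup_mem)
qed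

lemma hom_FreeGroup_inv_letter:
  assumes "h \<in> hom (FreeGroup X) (FreeGroup X)" "snd a \<in> X"
  shows "h [inv_letter a] = winv (h [a])"
  using hom_FreeGroup_winv[OF assms(1), of "[a]"] assms(2) by (simp add: winv_def)

lemma hom_FreeGroup_Cons:
  assumes "h \<in> hom (FreeGroup X) (FreeGroup X)" "a # w \<in> carrier (FreeGroup X)"
  shows "h (a # w) = foldr push (h [a]) (h w)"
proof -
  have "reduced (a # w)" "[a] \<in> carrier (FreeGroup X)" "w \<in> carrier (FreeGroup X)"
    using assms(2) by (auto simp: mem_FreeGroup dest: reduced_ConsD)
  then show ?thesis
    using hom_FreeGroup_mult[OF assms(1), of "[a]" w] by (simp add: push_reduced_Cons)
qed

lemma hom_FreeGroup_eqI:
  assumes "h \<in> hom (FreeGroup X) (FreeGroup X)" "k \<in> hom (FreeGroup X) (FreeGroup X)"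
    and "h \<in> extensional (carrier (FreeGroup X))" "k \<in> extensional (carrier (FreeGroup X))"
    and eq: "\<And>x. x \<in> X \<Longrightarrow> h [(False, x)] = k [(False, x)]"
  shows "h = k"
proof -
  have "(\<lambda>x. h [(False, x)]) \<in> X \<rightarrow> carrier (FreeGroup X)"
    using assms(1) by (auto intro: hom_FreeGroup_mem)
  from FreeGroup_universal[OF group_FreeGroup this] show ?thesis
    using assms by (metis (no_types, lifting))
qed

text \<open>Prescribing the values on inverse letters too spares later arguments the distinction
  between a generator and its inverse; \<open>inv\<close> is the compatibility this
  requires.\<close>

lemma hom_FreeGroup_letters:
  assumes f: "\<And>a. snd a \<in> X \<Longrightarrow> f a \<in> carrier (FreeGroup X)"
    and inv: "\<And>a. snd a \<in> X \<Longrightarrow> f (inv_letter a) = winv (f a)"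
  obtains h where "h \<in> hom (FreeGroup X) (FreeGroup X)"
    "h \<in> extensional (carrier (FreeGroup X))" "\<And>a. snd a \<in> X \<Longrightarrow> h [a] = f a"
proof -
  have "(\<lambda>x. f (False, x)) \<in> X \<rightarrow> carrier (FreeGroup X)"
    using f by auto
  from ex1_implies_ex[OF FreeGroup_universal[OF group_FreeGroup this]]
  obtain h where h: "h \<in> hom (FreeGroup X) (FreeGroup X)"
    "h \<in> extensional (carrier (FreeGroup X))" "\<And>x. x \<in> X \<Longrightarrow> h [(False, x)] = f (False, x)"
    by blast
  have "h [a] = f a" if "snd a \<in> X" for a
  proof (cases a)
    case (Pair s x)
    then have x: "x \<in> X" using that by simp
    show ?thesis
      using hom_FreeGroup_inv_letter[OF h(1), of "(False, x)"] inv[of "(False, x)"] h(3)[OF x] x Pair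
      by (cases s) (auto simp: inv_letter_def)
  qed
  then show thesis using that h by blast
qed

text \<open>It suffices to check on generators that the square is the identity, and a self-inverse
  map is bijective. The assumption \<open>square\<close> ranges over all homomorphisms extending
  \<open>f\<close>, because \<open>h\<close> is constructed only inside the proof.\<close>

lemma involutive_auto_letters:
  assumes f: "\<And>a. snd a \<in> X \<Longrightarrow> f a \<in> carrier (FreeGroup X)"
    and inv: "\<And>a. snd a \<in> X \<Longrightarrow> f (inv_letter a) = winv (f a)"
    and square: "\<And>h a. h \<in> hom (FreeGroup X) (FreeGroup X) \<Longrightarrow>
      (\<And>b. snd b \<in> X \<Longrightarrow> h [b] = f b) \<Longrightarrow> snd a \<in> X \<Longrightarrow> h (f a) = [a]"
  obtains h where "h \<in> square_id_autos (FreeGroup X)" "\<And>a. snd a \<in> X \<Longrightarrow> h [a] = f a"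
proof -
  let ?C = "carrier (FreeGroup X)"
  obtain h where h: "h \<in> hom (FreeGroup X) (FreeGroup X)" "h \<in> extensional ?C"
    and hf: "\<And>a. snd a \<in> X \<Longrightarrow> h [a] = f a"
    using hom_FreeGroup_letters[of X f, OF f inv] by metis
  interpret F: group "FreeGroup X" by (rule group_FreeGroup)
  have id: "compose ?C h h = (\<lambda>x\<in>?C. x)"
  proof (rule hom_FreeGroup_eqI[of _ X])
    show "compose ?C h h \<in> hom (FreeGroup X) (FreeGroup X)"
      by (rule F.hom_compose[OF h(1) h(1)])
    show "(\<lambda>x\<in>?C. x) \<in> hom (FreeGroup X) (FreeGroup X)"
      using F.id_in_auto by (simp add: auto_def)
    fix x assume "x \<in> X"
    then show "compose ?C h h [(False, x)] = (\<lambda>x\<in>?C. x) [(False, x)]"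
      using square[OF h(1) hf, of "(False, x)"] hf[of "(False, x)"] by (simp add: compose_eq)
  qed auto
  have "h (h w) = w" if "w \<in> ?C" for w
    using fun_cong[OF id, of w] that by (simp add: compose_eq)
  then have "bij_betw h ?C ?C"
    using hom_FreeGroup_mem[OF h(1)] by (intro bij_betw_byWitness[where f' = h]) auto
  then have "h \<in> square_id_autos (FreeGroup X)"
    using h id by (simp add: square_id_autos_def auto_def Bij_def)
  then show thesis using that hf by blast
qed

text \<open>Inverting \<open>b\<close> at the same time makes the transvection its own inverse:
  \<rho> sends the word ab to ab followed by the inverse of b, which is a.\<close>

lemma transvection_involution:
  assumes "snd a \<in> X" "snd b \<in> X" "snd a \<noteq> snd b"
  obtains \<rho> where "\<rho> \<in> square_id_autos (FreeGroup X)" "\<rho> [a] = [a, b]" "\<rho> [b] = [inv_letter b]"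
    "\<And>c. snd c \<in> X \<Longrightarrow> snd c \<noteq> snd a \<Longrightarrow> snd c \<noteq> snd b \<Longrightarrow> \<rho> [c] = [c]"
proof -
  define f where "f c = (if c = a then [a, b] else if c = inv_letter a then [inv_letter b, inv_letter a]
    else if snd c = snd b then [inv_letter c] else [c])" for c
  have ab: "a \<noteq> b" "b \<noteq> a" "a \<noteq> inv_letter b" "b \<noteq> inv_letter a"
    using assms(3) by auto
  obtain \<rho> where "\<rho> \<in> square_id_autos (FreeGroup X)" "\<And>a. snd a \<in> X \<Longrightarrow> \<rho> [a] = f a"
  proof (rule involutive_auto_letters)
    show "f c \<in> carrier (FreeGroup X)" if "snd c \<in> X" for c
      using that assms ab by (auto simp: f_def mem_FreeGroup reduced_def)
    show "f (inv_letter c) = winv (f c)" if "snd c \<in> X" for c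
      using that assms ab by (auto simp: f_def winv_def)
    fix h and c :: "'a letter"
    assume h: "h \<in> hom (FreeGroup X) (FreeGroup X)"
      and hf: "\<And>b. snd b \<in> X \<Longrightarrow> h [b] = f b" and c: "snd c \<in> X"
    have red: "[a, b] \<in> carrier (FreeGroup X)" "[inv_letter b, inv_letter a] \<in> carrier (FreeGroup X)"
      using assms ab by (auto simp: mem_FreeGroup reduced_def)
    show "h (f c) = [c]"
      using hom_FreeGroup_Cons[OF h red(1)] hom_FreeGroup_Cons[OF h red(2)]
        hf[of a] hf[of b] hf[of "inv_letter a"] hf[of "inv_letter b"] hf[of c]
        hf[of "inv_letter c"] c assms ab
      by (auto simp: f_def)
  qed blast
  then show thesis
    using that[of \<rho>] assms ab by (auto simp: f_def inv_letter_cases)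
qed

text \<open>The map \<open>s\<close> exchanges \<open>a\<close> and \<open>b\<close>, and their
  inverses accordingly. The case \<open>b = inv_letter a\<close> is included; \<sigma> then inverts
  a single generator.\<close>

lemma letter_swap_involution:
  assumes "snd a \<in> X" "snd b \<in> X" "a \<noteq> b"
  obtains \<sigma> where "\<sigma> \<in> square_id_autos (FreeGroup X)" "\<sigma> [a] = [b]"
    "\<And>c. snd c \<in> X \<Longrightarrow> \<exists>d. snd d \<in> X \<and> \<sigma> [c] = [d]"
    "\<And>c. snd c \<in> X \<Longrightarrow> snd c \<noteq> snd a \<Longrightarrow> snd c \<noteq> snd b \<Longrightarrow> \<sigma> [c] = [c]"
proof -
  define s where "s c = (if c = a then b else if c = b then a
    else if c = inv_letter a then inv_letter b else if c = inv_letter b then inv_letter a else c)" for c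
  have s: "snd (s c) \<in> X" "s (inv_letter c) = inv_letter (s c)" "s (s c) = c" if "snd c \<in> X" for c
    using that assms by (auto simp: s_def inv_letter_eq_iff)
  obtain \<sigma> where "\<sigma> \<in> square_id_autos (FreeGroup X)" "\<And>a. snd a \<in> X \<Longrightarrow> \<sigma> [a] = [s a]"
    by (rule involutive_auto_letters[of X "\<lambda>c. [s c]"]) (auto simp: s winv_def)
  moreover have "s a = b" by (simp add: s_def)
  moreover have "s c = c" if "snd c \<noteq> snd a" "snd c \<noteq> snd b" for c
    using that by (auto simp: s_def)
  ultimately show thesis
    using that[of \<sigma>] assms s(1) by metis
qed


section \<open>Nielsen reduction\<close>

text \<open>This is Nielsen's condition that in a product of three images the middle one is not
  cancelled entirely. The choice \<open>a = b = c\<close> shows that no image of a letter is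
  empty.\<close>

definition nielsen_reduced :: "'a set \<Rightarrow> ('a letter list \<Rightarrow> 'a letter list) \<Rightarrow> bool" where
  "nielsen_reduced X \<phi> \<longleftrightarrow> (\<forall>a b c. snd a \<in> X \<longrightarrow> snd b \<in> X \<longrightarrow> snd c \<in> X \<longrightarrow>
     b \<noteq> inv_letter a \<longrightarrow> c \<noteq> inv_letter b \<longrightarrow>
     cancellation (\<phi> [a]) (\<phi> [b]) + cancellation (\<phi> [b]) (\<phi> [c]) < length (\<phi> [b]))"

lemma nielsen_reducedD:
  assumes "nielsen_reduced X \<phi>" "snd a \<in> X" "snd b \<in> X" "snd c \<in> X"
    "b \<noteq> inv_letter a" "c \<noteq> inv_letter b"
  shows "cancellation (\<phi> [a]) (\<phi> [b]) + cancellation (\<phi> [b]) (\<phi> [c]) < length (\<phi> [b])"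
  using assms unfolding nielsen_reduced_def by blast

text \<open>In the product of the images of the letters of a reduced word, something of every factor
  survives. The induction keeps track of the part of the first factor that is not cancelled by the
  second one.\<close>

lemma nielsen_reduced_prefix:
  assumes \<phi>: "\<phi> \<in> hom (FreeGroup X) (FreeGroup X)" and red: "nielsen_reduced X \<phi>"
    and "a # w \<in> carrier (FreeGroup X)"
    and "k = (if w = [] then 0 else cancellation (\<phi> [a]) (\<phi> [hd w]))"
  shows "length (\<phi> [a]) - k \<le> lcp (\<phi> [a]) (\<phi> (a # w)) \<and>
    length w + length (\<phi> [a]) \<le> length (\<phi> (a # w)) + k"
  using assms(3,4)
proof (induction w arbitrary: a k)
  case Nil
  then show ?case by (simp add: le_lcp_iff)
next
  case (Cons b w)
  define l where "l = (if w = [] then 0 else cancellation (\<phi> [b]) (\<phi> [hd w]))"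
  have k: "k = cancellation (\<phi> [a]) (\<phi> [b])" using Cons.prems by simp
  have bw: "b # w \<in> carrier (FreeGroup X)" and aX: "snd a \<in> X" and bX: "snd b \<in> X"
    and ba: "b \<noteq> inv_letter a"
    using Cons.prems(1) by (auto simp: mem_FreeGroup reduced_def)
  have IH: "length (\<phi> [b]) - l \<le> lcp (\<phi> [b]) (\<phi> (b # w))"
    "length w + length (\<phi> [b]) \<le> length (\<phi> (b # w)) + l"
    using Cons.IH[OF bw l_def] by auto
  have kl: "k + l < length (\<phi> [b])"
  proof (cases w)
    case Nil
    \<comment> \<open>With no letter after \<open>b\<close>, the letter \<open>b\<close> itself
      serves as the third one.\<close>
    then show ?thesis
      using nielsen_reducedD[OF red aX bX bX ba inv_letter_neq(2)] by (simp add: k l_def)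
  next
    case (Cons c v)
    then have "snd c \<in> X" "c \<noteq> inv_letter b"
      using bw by (auto simp: mem_FreeGroup reduced_def)
    from nielsen_reducedD[OF red aX bX this(1) ba this(2)] show ?thesis
      by (simp add: k l_def Cons)
  qed
  have mem: "\<phi> [a] \<in> carrier (FreeGroup X)" "\<phi> (b # w) \<in> carrier (FreeGroup X)"
    using hom_FreeGroup_mem[OF \<phi>] aX bw by simp_all
  \<comment> \<open>More of \<open>\<phi> [b]\<close> survives as a prefix of
    \<open>\<phi> (b # w)\<close> than \<open>\<phi> [a]\<close> cancels, so
    \<open>\<phi> [a]\<close> cancels against the whole product exactly as against
    \<open>\<phi> [b]\<close>.\<close>
  have "lcp (winv (\<phi> [a])) (\<phi> [b]) < lcp (\<phi> [b]) (\<phi> (b # w))"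
    using kl IH(1) unfolding k cancellation_def by simp
  then have c: "cancellation (\<phi> [a]) (\<phi> (b # w)) = k"
    unfolding k cancellation_def by (rule lcp_ultrametric)
  have "\<phi> (a # b # w) = take (length (\<phi> [a]) - k) (\<phi> [a]) @ drop k (\<phi> (b # w))"
    using hom_FreeGroup_Cons[OF \<phi> Cons.prems(1)] mem
      mult_cancellation[of "\<phi> [a]" "\<phi> (b # w)"] c
    by (simp add: mem_FreeGroup)
  moreover have "k \<le> length (\<phi> [a])" "k \<le> length (\<phi> (b # w))"
    using cancellation_le c by metis+
  ultimately show ?case
    using IH(2) kl by (simp add: le_lcp_iff, linarith)
qed

text \<open>By the preceding estimate every later factor contributes a letter. For the first factor,
  which is treated as if preceded by itself, the condition shows that it is not cancelled entirely
  either.\<close>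

lemma nielsen_reduced_length:
  assumes "\<phi> \<in> hom (FreeGroup X) (FreeGroup X)" and red: "nielsen_reduced X \<phi>"
    and w: "w \<in> carrier (FreeGroup X)"
  shows "length w \<le> length (\<phi> w)"
proof (cases w)
  case (Cons a v)
  define k where "k = (if v = [] then 0 else cancellation (\<phi> [a]) (\<phi> [hd v]))"
  have aX: "snd a \<in> X" using w Cons by (auto simp: mem_FreeGroup)
  have "k < length (\<phi> [a])"
  proof (cases v)
    case Nil
    then show ?thesis
      using nielsen_reducedD[OF red aX aX aX inv_letter_neq(2) inv_letter_neq(2)]
      by (auto simp: k_def)
  next
    case (Cons b u)
    then have "snd b \<in> X" "b \<noteq> inv_letter a"
      using w \<open>w = a # v\<close> by (auto simp: mem_FreeGroup reduced_def)
    from nielsen_reducedD[OF red aX aX this(1) inv_letter_neq(2) this(2)] show ?thesis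
      by (simp add: k_def Cons)
  qed
  then show ?thesis
    using nielsen_reduced_prefix[OF assms(1,2) w[unfolded Cons] k_def] Cons by simp
qed simp

lemma auto_hom: "\<phi> \<in> auto G \<Longrightarrow> \<phi> \<in> hom G G"
  by (simp add: auto_def)

lemma auto_bij: "\<phi> \<in> auto G \<Longrightarrow> bij_betw \<phi> (carrier G) (carrier G)"
  by (simp add: auto_def Bij_def)

lemma auto_extensional: "\<phi> \<in> auto G \<Longrightarrow> \<phi> \<in> extensional (carrier G)"
  by (simp add: auto_def Bij_def)

lemma hom_FreeGroup_Nil: "h \<in> hom (FreeGroup X) (FreeGroup X) \<Longrightarrow> h [] = []"
  using hom_one[OF _ group_FreeGroup group_FreeGroup] by fastforce

lemma auto_letter_neq_Nil:
  assumes "\<phi> \<in> auto (FreeGroup X)" "snd a \<in> X"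
  shows "\<phi> [a] \<noteq> []"
proof
  assume "\<phi> [a] = []"
  then have "\<phi> [a] = \<phi> []" using hom_FreeGroup_Nil[OF auto_hom[OF assms(1)]] by simp
  moreover have "[] \<in> carrier (FreeGroup X)" by (simp add: mem_FreeGroup)
  ultimately show False
    using auto_bij[OF assms(1)] assms(2) by (auto simp: bij_betw_def dest: inj_onD)
qed

text \<open>Surjectivity gives each letter a preimage, which by the length estimate is a single
  letter. Choosing preimages is an injective map of the finite set of letters to itself, so every
  letter is such a preimage.\<close>

lemma nielsen_reduced_letters:
  assumes X: "finite X" and \<phi>: "\<phi> \<in> auto (FreeGroup X)" and red: "nielsen_reduced X \<phi>"
    and a: "snd a \<in> X"
  shows "\<exists>b. snd b \<in> X \<and> \<phi> [a] = [b]"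
proof -
  let ?L = "UNIV \<times> X"
  have "\<exists>c. c \<in> ?L \<and> \<phi> [c] = [b]" if "b \<in> ?L" for b
  proof -
    have "[b] \<in> \<phi> ` carrier (FreeGroup X)"
      using that auto_bij[OF \<phi>] by (auto simp: bij_betw_def)
    then obtain w where w: "w \<in> carrier (FreeGroup X)" "\<phi> w = [b]" by auto
    then have "length w \<le> 1" "w \<noteq> []"
      using nielsen_reduced_length[OF auto_hom[OF \<phi>] red, of w]
        hom_FreeGroup_Nil[OF auto_hom[OF \<phi>]] by auto
    then obtain c where "w = [c]" by (cases w) auto
    then show ?thesis using w by (cases c) auto
  qed
  then obtain g where g: "\<And>b. b \<in> ?L \<Longrightarrow> g b \<in> ?L \<and> \<phi> [g b] = [b]"
    by metis
  have "inj_on g ?L" using g by (metis inj_onI list.inject)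
  moreover have "g ` ?L \<subseteq> ?L" using g by blast
  ultimately have "g ` ?L = ?L"
    using X by (intro endo_inj_surj) auto
  moreover have "a \<in> ?L" using a by (cases a) auto
  ultimately obtain b where "b \<in> ?L" "a = g b" by blast
  then show ?thesis using g by fastforce
qed

definition shortens :: "nat \<Rightarrow> ('a letter \<Rightarrow> nat) \<Rightarrow> 'a letter list \<Rightarrow> 'a letter list \<Rightarrow> bool" where
  "shortens B d u v \<longleftrightarrow> length (foldr push u v) < length u \<or>
     length (foldr push u v) = length u \<and> rank B d (foldr push u v) < rank B d u"

text \<open>Take letters violating the condition, with images u, v, w. Either more than half of some
  factor is cancelled and a length drops, or u and w each cancel exactly half of v. In the latter
  case v consists of two halves p and q, and comparing p with the inverse of q decides whether u or
  the inverse of w is to be multiplied.\<close>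

lemma shortening_exists:
  assumes \<phi>: "\<phi> \<in> auto (FreeGroup X)" and "\<not> nielsen_reduced X \<phi>"
    and d: "\<And>a. snd a \<in> X \<Longrightarrow> d a < B" "inj_on d (UNIV \<times> X)"
  obtains a b where "snd a \<in> X" "snd b \<in> X" "snd a \<noteq> snd b" "shortens B d (\<phi> [a]) (\<phi> [b])"
proof -
  define S where "S a b \<longleftrightarrow> snd a \<in> X \<and> snd b \<in> X \<and> snd a \<noteq> snd b \<and> shortens B d (\<phi> [a]) (\<phi> [b])"
    for a b
  have red: "reduced (\<phi> [a])" if "snd a \<in> X" for a
    using hom_FreeGroup_mem[OF auto_hom[OF \<phi>], of "[a]"] that by (simp add: mem_FreeGroup)
  have winv: "\<phi> [inv_letter a] = winv (\<phi> [a])" if "snd a \<in> X" for a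
    using hom_FreeGroup_inv_letter[OF auto_hom[OF \<phi>] that] .
  have self: "2 * cancellation (\<phi> [a]) (\<phi> [a]) < length (\<phi> [a])" if "snd a \<in> X" for a
    using cancellation_self[OF red[OF that] auto_letter_neq_Nil[OF \<phi> that]] .
  have by_length: "S a b" if "snd a \<in> X" "snd b \<in> X" "b \<noteq> inv_letter a"
    "length (\<phi> [b]) < 2 * cancellation (\<phi> [a]) (\<phi> [b])" for a b
  proof -
    \<comment> \<open>A word cancels less than half against itself, so the letters belong to
      different generators, as the transvection requires.\<close>
    have "a \<noteq> b" using self[OF that(2)] that(4) by auto
    then have "snd a \<noteq> snd b" using that(3) by (auto simp: inv_letter_cases)
    moreover have "length (foldr push (\<phi> [a]) (\<phi> [b])) < length (\<phi> [a])"
      using length_mult[OF red red, OF that(1,2)] that(4) by simp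
    ultimately show ?thesis using that by (simp add: S_def shortens_def)
  qed
  have by_rank: "S a b" if "snd a \<in> X" "snd b \<in> X" "b \<noteq> inv_letter a"
    "2 * cancellation (\<phi> [a]) (\<phi> [b]) = length (\<phi> [b])" "length (\<phi> [b]) \<le> length (\<phi> [a])"
    "numeral_value B d (winv (drop (cancellation (\<phi> [a]) (\<phi> [b])) (\<phi> [b])))
      < numeral_value B d (take (cancellation (\<phi> [a]) (\<phi> [b])) (\<phi> [b]))" for a b
  proof -
    have "a \<noteq> b" using self[OF that(2)] that(4) by auto
    then have "snd a \<noteq> snd b" using that(3) by (auto simp: inv_letter_cases)
    moreover have "B > 0" using d(1)[OF that(1)] by simp
    ultimately show ?thesis
      using rank_decreases[OF _ red[OF that(1)] red[OF that(2)] that(4,5,6)] that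
      by (simp add: S_def shortens_def)
  qed
  obtain a b c where abc: "snd a \<in> X" "snd b \<in> X" "snd c \<in> X" "b \<noteq> inv_letter a" "c \<noteq> inv_letter b"
    and ge: "length (\<phi> [b]) \<le> cancellation (\<phi> [a]) (\<phi> [b]) + cancellation (\<phi> [b]) (\<phi> [c])"
    using assms(2) unfolding nielsen_reduced_def by (auto simp: not_less)
  let ?u = "\<phi> [a]" and ?v = "\<phi> [b]" and ?w = "\<phi> [c]"
  have swap: "cancellation (\<phi> [inv_letter b]) (\<phi> [inv_letter a]) = cancellation ?u ?v"
    "cancellation (\<phi> [inv_letter c]) (\<phi> [inv_letter b]) = cancellation ?v ?w"
    using abc by (simp_all add: winv cancellation_winv)
  have neq: "inv_letter a \<noteq> inv_letter (inv_letter b)" "inv_letter b \<noteq> inv_letter (inv_letter c)"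
    using abc by (auto simp: inv_letter_eq_iff)
  have "\<exists>a b. S a b"
  \<comment> \<open>If more than half of a factor is cancelled, multiplying its neighbour by it
    shortens the neighbour. Passing to inverses turns multiplication on the left into multiplication
    on the right.\<close>
  proof (cases "length ?v < 2 * cancellation ?u ?v \<or> length ?v < 2 * cancellation ?v ?w \<or>
      length ?u < 2 * cancellation ?u ?v \<or> length ?w < 2 * cancellation ?v ?w")
    case True
    then show ?thesis
      using by_length[of a b] by_length[of "inv_letter c" "inv_letter b"]
        by_length[of "inv_letter b" "inv_letter a"] by_length[of b c]
        abc neq swap unfolding winv[OF abc(1)] winv[OF abc(2)] winv[OF abc(3)]
        length_winv snd_inv_letter cancellation_winv by blast
  next
    case False
    define k where "k = cancellation ?u ?v"
    \<comment> \<open>Both cancellations are at most half of \<open>?v\<close> and together exhaust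
      it.\<close>
    have k: "cancellation ?u ?v = k" "cancellation ?v ?w = k" "length ?v = 2 * k"
      "2 * k \<le> length ?u" "2 * k \<le> length ?w"
      using False ge by (auto simp: k_def)
    define p q where "p = take k ?v" and "q = drop k ?v"
    \<comment> \<open>Otherwise \<open>?v\<close> and its inverse would share their first half,
      against \<open>cancellation_self\<close>.\<close>
    have "p \<noteq> winv q"
    proof
      assume "p = winv q"
      then have "k \<le> cancellation ?v ?v"
        unfolding cancellation_def le_lcp_iff using k by (simp add: take_winv p_def q_def)
      then show False using self[OF abc(2)] k by simp
    qed
    moreover have "p = winv q" if "numeral_value B d p = numeral_value B d (winv q)"
    proof (rule numeral_value_inj[OF _ that, of "UNIV \<times> X"])
      have v: "?v \<in> carrier (FreeGroup X)"
        using hom_FreeGroup_mem[OF auto_hom[OF \<phi>], of "[b]"] abc by simp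
      then have sub: "set ?v \<subseteq> UNIV \<times> X" "set (winv ?v) \<subseteq> UNIV \<times> X"
        using winv_mem_FreeGroup[OF v] by (auto simp: FreeGroup_def)
      have "winv q = take k (winv ?v)" using k by (simp add: take_winv q_def)
      then show "set p \<subseteq> UNIV \<times> X" "set (winv q) \<subseteq> UNIV \<times> X"
        using sub set_take_subset unfolding p_def by (metis subset_trans)+
    qed (use k d in \<open>auto simp: p_def q_def\<close>)
    ultimately consider "numeral_value B d (winv q) < numeral_value B d p" |
      "numeral_value B d p < numeral_value B d (winv q)"
      by (metis nat_neq_iff)
    then show ?thesis
    proof cases
      case 1
      then have "S a b" using by_rank[of a b] abc k by (simp add: p_def q_def)
      then show ?thesis by blast
    next
      case 2
      have "winv (drop k (winv ?v)) = p" "take k (winv ?v) = winv q"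
        using k by (simp_all add: take_winv drop_winv p_def q_def)
      then have "S (inv_letter c) (inv_letter b)"
        using by_rank[of "inv_letter c" "inv_letter b"]
          abc k neq swap 2 by (simp add: winv)
      then show ?thesis by blast
    qed
  qed
  then show thesis using that by (auto simp: S_def)
qed

section \<open>The group generated by the involutive automorphisms\<close>

lemma auto_subset_Bij: "auto G \<subseteq> Bij (carrier G)"
  by (auto simp: auto_def)

lemma mult_AutoGroup:
  "\<phi> \<in> auto G \<Longrightarrow> \<psi> \<in> auto G \<Longrightarrow> \<phi> \<otimes>\<^bsub>AutoGroup G\<^esub> \<psi> = compose (carrier G) \<phi> \<psi>"
  using auto_subset_Bij[of G] by (auto simp: AutoGroup_def BijGroup_def)

lemma square_id_autos_subset: "square_id_autos G \<subseteq> auto G"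
  by (auto simp: square_id_autos_def)

lemma (in group) compose_auto:
  assumes "\<phi> \<in> auto G" "\<psi> \<in> auto G"
  shows "compose (carrier G) \<phi> \<psi> \<in> auto G"
  using assms hom_compose[of \<psi> G \<phi> G] compose_Bij by (auto simp: auto_def)

lemma (in group) square_id_auto_group_subset: "square_id_auto_group G \<subseteq> auto G"
  using group.generate_incl[OF AutoGroup, of "square_id_autos G"] square_id_autos_subset[of G]
  by (simp add: square_id_auto_group_def AutoGroup_def)

lemma (in group) compose_cancel_square_id:
  assumes "\<sigma> \<in> square_id_autos G" "\<phi> \<in> auto G"
  shows "compose (carrier G) \<sigma> (compose (carrier G) \<sigma> \<phi>) = \<phi>"
    and "compose (carrier G) (compose (carrier G) \<phi> \<sigma>) \<sigma> = \<phi>"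
proof -
  have Bij: "\<phi> \<in> Bij (carrier G)" "\<sigma> \<in> Bij (carrier G)"
    using assms auto_subset_Bij[of G] by (auto simp: square_id_autos_def)
  have id: "compose (carrier G) \<sigma> \<sigma> = (\<lambda>x\<in>carrier G. x)"
    using assms(1) by (simp add: square_id_autos_def)
  show "compose (carrier G) \<sigma> (compose (carrier G) \<sigma> \<phi>) = \<phi>"
    using compose_assoc[of \<phi> "carrier G" "carrier G" \<sigma> \<sigma>] Bij id
    by (simp add: Bij_imp_funcset Bij_imp_extensional)
  show "compose (carrier G) (compose (carrier G) \<phi> \<sigma>) \<sigma> = \<phi>"
    using compose_assoc[of \<sigma> "carrier G" "carrier G" \<phi> \<sigma>] Bij id
      compose_Id[OF Bij_imp_funcset Bij_imp_extensional, OF Bij(1) Bij(1)]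
    by (simp add: Bij_imp_funcset)
qed

text \<open>The reduction step of both inductions: composition on the left serves for letter swaps,
  on the right for transvections.\<close>

lemma (in group) square_id_auto_group_cancel:
  assumes \<sigma>: "\<sigma> \<in> square_id_autos G" and \<phi>: "\<phi> \<in> auto G"
    and "compose (carrier G) \<sigma> \<phi> \<in> square_id_auto_group G \<or>
      compose (carrier G) \<phi> \<sigma> \<in> square_id_auto_group G"
  shows "\<phi> \<in> square_id_auto_group G"
proof -
  have \<sigma>_auto: "\<sigma> \<in> auto G" using \<sigma> square_id_autos_subset[of G] by auto
  have \<sigma>_gen: "\<sigma> \<in> square_id_auto_group G"
    using \<sigma> by (simp add: square_id_auto_group_def generate.incl)
  have closed: "compose (carrier G) f g \<in> square_id_auto_group G"
    if "f \<in> square_id_auto_group G" "g \<in> square_id_auto_group G" for f g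
    using generate.eng[of f "AutoGroup G" "square_id_autos G" g] that square_id_auto_group_subset
      mult_AutoGroup[of f G g]
    by (simp add: square_id_auto_group_def subset_iff)
  show ?thesis
    using assms(3) closed[OF \<sigma>_gen] closed[OF _ \<sigma>_gen] compose_cancel_square_id[OF \<sigma> \<phi>]
    by metis
qed

text \<open>Induction on the number of generators that are not fixed. If \<open>x\<close> is sent to
  another letter \<open>a\<close>, following \<phi> by the swap of \<open>a\<close> and
  \<open>x\<close> fixes \<open>x\<close> and keeps all generators fixed before.\<close>

lemma letter_permutation_in_square_id_auto_group:
  assumes X: "finite X" and "\<phi> \<in> auto (FreeGroup X)"
    and "\<And>a. snd a \<in> X \<Longrightarrow> \<exists>b. snd b \<in> X \<and> \<phi> [a] = [b]"
  shows "\<phi> \<in> square_id_auto_group (FreeGroup X)"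
  using assms(2,3)
proof (induction "card {x \<in> X. \<phi> [(False, x)] \<noteq> [(False, x)]}" arbitrary: \<phi> rule: less_induct)
  case less
  let ?C = "carrier (FreeGroup X)"
  interpret F: group "FreeGroup X" by (rule group_FreeGroup)
  note hom = auto_hom[OF less.prems(1)]
  show ?case
  proof (cases "\<forall>x\<in>X. \<phi> [(False, x)] = [(False, x)]")
    case True
    have "\<phi> = (\<lambda>w\<in>?C. w)"
      using True F.id_in_auto
      by (intro hom_FreeGroup_eqI[OF hom _ auto_extensional[OF less.prems(1)]])
        (auto intro: auto_hom)
    then have "\<phi> = \<one>\<^bsub>AutoGroup (FreeGroup X)\<^esub>"
      by (simp add: AutoGroup_def BijGroup_def)
    then show ?thesis by (simp add: square_id_auto_group_def generate.one)
  next
    case False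
    then obtain x where x: "x \<in> X" "\<phi> [(False, x)] \<noteq> [(False, x)]" by blast
    obtain a where a: "snd a \<in> X" "\<phi> [(False, x)] = [a]"
      using less.prems(2)[of "(False, x)"] x(1) by auto
    obtain \<sigma> where \<sigma>: "\<sigma> \<in> square_id_autos (FreeGroup X)" "\<sigma> [a] = [(False, x)]"
      "\<And>c. snd c \<in> X \<Longrightarrow> \<exists>d. snd d \<in> X \<and> \<sigma> [c] = [d]"
      "\<And>c. snd c \<in> X \<Longrightarrow> snd c \<noteq> snd a \<Longrightarrow> snd c \<noteq> x \<Longrightarrow> \<sigma> [c] = [c]"
      using letter_swap_involution[of a X "(False, x)"] a x by auto
    define \<psi> where "\<psi> = compose ?C \<sigma> \<phi>"
    have \<psi>: "\<psi> [c] = \<sigma> (\<phi> [c])" if "snd c \<in> X" for c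
      using that by (simp add: \<psi>_def compose_eq)
    have \<psi>_auto: "\<psi> \<in> auto (FreeGroup X)"
      using F.compose_auto less.prems(1) \<sigma>(1) square_id_autos_subset unfolding \<psi>_def by blast
    have "\<psi> [(False, y)] = [(False, y)]" if y: "y \<in> X" "\<phi> [(False, y)] = [(False, y)]" for y
    proof -
      have "y \<noteq> x" using x y by auto
      moreover have "y \<noteq> snd a"
      proof
        \<comment> \<open>Then \<phi> fixes \<open>a\<close>, which is also the image of
          \<open>x\<close>; injectivity identifies the two.\<close>
        assume "y = snd a"
        then have "a = (False, y) \<or> a = inv_letter (False, y)"
          by (simp add: inv_letter_cases[symmetric])
        then have "\<phi> [a] = [a]"
          using y hom_FreeGroup_inv_letter[OF hom, of "(False, y)"] by (auto simp: winv_def)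
        then have "\<phi> [a] = \<phi> [(False, x)]" using a by simp
        then have "[a] = [(False, x)]"
          using inj_onD[OF bij_betw_imp_inj_on[OF auto_bij[OF less.prems(1)]], of "[a]" "[(False, x)]"]
            a x by simp
        then show False using x a by simp
      qed
      ultimately show ?thesis using \<psi>[of "(False, y)"] \<sigma>(4)[of "(False, y)"] y by simp
    qed
    moreover have "\<psi> [(False, x)] = [(False, x)]"
      using \<psi>[of "(False, x)"] x a \<sigma>(2) by simp
    ultimately have "{y \<in> X. \<psi> [(False, y)] \<noteq> [(False, y)]} \<subset> {y \<in> X. \<phi> [(False, y)] \<noteq> [(False, y)]}"
      using x by blast
    then have "card {y \<in> X. \<psi> [(False, y)] \<noteq> [(False, y)]} < card {y \<in> X. \<phi> [(False, y)] \<noteq> [(False, y)]}"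
      using X by (intro psubset_card_mono) auto
    moreover have "\<exists>b. snd b \<in> X \<and> \<psi> [c] = [b]" if "snd c \<in> X" for c
      using less.prems(2)[OF that] \<sigma>(3) \<psi>[OF that] by metis
    ultimately have "\<psi> \<in> square_id_auto_group (FreeGroup X)"
      using less.hyps \<psi>_auto by blast
    then show ?thesis
      using F.square_id_auto_group_cancel[OF \<sigma>(1) less.prems(1)] by (simp add: \<psi>_def)
  qed
qed

text \<open>Only the summand at the generator of \<open>a\<close> changes, since the image of
  \<open>b\<close> is merely inverted. Adding the old and new summands crosswise avoids subtraction
  of natural numbers.\<close>

lemma sum_transvection:
  fixes m :: "'a letter list \<Rightarrow> nat"
  assumes X: "finite X" and m: "\<And>w. m (winv w) = m w"
    and \<phi>: "\<phi> \<in> auto (FreeGroup X)"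
    and \<rho>: "\<rho> \<in> square_id_autos (FreeGroup X)" "\<rho> [a] = [a, b]" "\<rho> [b] = [inv_letter b]"
      "\<And>c. snd c \<in> X \<Longrightarrow> snd c \<noteq> snd a \<Longrightarrow> snd c \<noteq> snd b \<Longrightarrow> \<rho> [c] = [c]"
    and ab: "snd a \<in> X" "snd b \<in> X" "snd a \<noteq> snd b"
  shows "(\<Sum>x\<in>X. m (compose (carrier (FreeGroup X)) \<phi> \<rho> [(False, x)])) + m (\<phi> [a]) =
    (\<Sum>x\<in>X. m (\<phi> [(False, x)])) + m (foldr push (\<phi> [a]) (\<phi> [b]))"
proof -
  let ?\<psi> = "compose (carrier (FreeGroup X)) \<phi> \<rho>"
  interpret F: group "FreeGroup X" by (rule group_FreeGroup)
  have \<psi>: "?\<psi> \<in> auto (FreeGroup X)"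
    using F.compose_auto \<phi> \<rho>(1) square_id_autos_subset by blast
  \<comment> \<open>The sums run over generators, whereas \<open>a\<close> and \<open>b\<close> may
    be inverse letters.\<close>
  have sign: "m (h [(False, snd c)]) = m (h [c])" if "h \<in> auto (FreeGroup X)" "snd c \<in> X" for h c
    using hom_FreeGroup_inv_letter[OF auto_hom[OF that(1)], of c] that(2) m
    by (cases c; cases "fst c") (auto simp: inv_letter_def)
  have "[a, b] \<in> carrier (FreeGroup X)"
    using ab by (auto simp: mem_FreeGroup reduced_def)
  then have "?\<psi> [a] = foldr push (\<phi> [a]) (\<phi> [b])"
    using hom_FreeGroup_Cons[OF auto_hom[OF \<phi>], of a "[b]"] ab \<rho>(2) by (simp add: compose_eq)
  then have moved: "m (?\<psi> [(False, snd a)]) = m (foldr push (\<phi> [a]) (\<phi> [b]))"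
    using sign[OF \<psi> ab(1)] by simp
  have fixed: "m (?\<psi> [(False, x)]) = m (\<phi> [(False, x)])" if "x \<in> X - {snd a}" for x
  proof (cases "x = snd b")
    case True
    have "?\<psi> [b] = winv (\<phi> [b])"
      using ab \<rho>(3) hom_FreeGroup_inv_letter[OF auto_hom[OF \<phi>], of b] by (simp add: compose_eq)
    then show ?thesis using sign[OF \<psi> ab(2)] sign[OF \<phi> ab(2)] True m by simp
  next
    case False
    then show ?thesis using that \<rho>(4)[of "(False, x)"] by (simp add: compose_eq)
  qed
  have "(\<Sum>x\<in>X - {snd a}. m (?\<psi> [(False, x)])) = (\<Sum>x\<in>X - {snd a}. m (\<phi> [(False, x)]))"
    using fixed by (intro sum.cong) auto
  then show ?thesis
    using sum.remove[OF X ab(1), of "\<lambda>x. m (?\<psi> [(False, x)])"]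
      sum.remove[OF X ab(1), of "\<lambda>x. m (\<phi> [(False, x)])"] moved sign[OF \<phi> ab(1)]
    by simp
qed

theorem square_id_auto_group_FreeGroup:
  assumes X: "finite X"
  shows "square_id_auto_group (FreeGroup X) = auto (FreeGroup X)"
proof
  interpret F: group "FreeGroup X" by (rule group_FreeGroup)
  show "square_id_auto_group (FreeGroup X) \<subseteq> auto (FreeGroup X)"
    by (rule F.square_id_auto_group_subset)
  \<comment> \<open>A numbering of the finitely many letters by the numbers below \<open>B\<close>
    supplies the digits for \<open>rank\<close>.\<close>
  have "finite (UNIV \<times> X :: 'a letter set)" using X by simp
  from finite_imp_inj_to_nat_seg[OF this] obtain d :: "'a letter \<Rightarrow> nat" and B
    where d: "d ` (UNIV \<times> X) = {i. i < B}" "inj_on d (UNIV \<times> X)" by auto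
  have dB: "d a < B" if "snd a \<in> X" for a
    using d(1) that by (metis UNIV_I imageI mem_Collect_eq mem_Times_iff)
  define total where "total m \<phi> = (\<Sum>x\<in>X. m (\<phi> [(False, x)]))"
    for m :: "'a letter list \<Rightarrow> nat" and \<phi>
  show "auto (FreeGroup X) \<subseteq> square_id_auto_group (FreeGroup X)"
  proof
    fix \<phi> assume "\<phi> \<in> auto (FreeGroup X)"
    then show "\<phi> \<in> square_id_auto_group (FreeGroup X)"
    \<comment> \<open>The order is lexicographic: total length first, then total rank.\<close>
    proof (induction \<phi> rule: wf_induct_rule[OF wf_measures[of "[total length, total (rank B d)]"]])
      case (1 \<phi>)
      show ?case
      proof (cases "nielsen_reduced X \<phi>")
        case True
        then show ?thesis
          using letter_permutation_in_square_id_auto_group[OF X 1(2)]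
            nielsen_reduced_letters[OF X 1(2)] by blast
      next
        case False
        obtain a b where ab: "snd a \<in> X" "snd b \<in> X" "snd a \<noteq> snd b"
          and less: "shortens B d (\<phi> [a]) (\<phi> [b])"
          using shortening_exists[OF 1(2) False dB d(2)] by blast
        obtain \<rho> where \<rho>: "\<rho> \<in> square_id_autos (FreeGroup X)" "\<rho> [a] = [a, b]" "\<rho> [b] = [inv_letter b]"
          "\<And>c. snd c \<in> X \<Longrightarrow> snd c \<noteq> snd a \<Longrightarrow> snd c \<noteq> snd b \<Longrightarrow> \<rho> [c] = [c]"
          using transvection_involution[OF ab] by blast
        define \<psi> where "\<psi> = compose (carrier (FreeGroup X)) \<phi> \<rho>"
        have eq: "total m \<psi> + m (\<phi> [a]) = total m \<phi> + m (foldr push (\<phi> [a]) (\<phi> [b]))"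
          if "\<And>w. m (winv w) = m w" for m
          unfolding total_def \<psi>_def using X that 1(2) \<rho> ab by (rule sum_transvection)
        have "(\<psi>, \<phi>) \<in> measures [total length, total (rank B d)]"
          using less eq[of length] eq[of "rank B d"] by (auto simp: shortens_def)
        moreover have "\<psi> \<in> auto (FreeGroup X)"
          using F.compose_auto 1(2) \<rho>(1) square_id_autos_subset unfolding \<psi>_def by blast
        ultimately show ?thesis
          using 1(1) F.square_id_auto_group_cancel[OF \<rho>(1) 1(2)] by (simp add: \<psi>_def)
      qed
    qed
  qed
qed


section \<open>Anti-automorphisms of groups\<close>

context group
begin

lemma anti_auto_Bij: "\<alpha> \<in> anti_auto G \<Longrightarrow> \<alpha> \<in> Bij (carrier G)"
  by (simp add: anti_auto_def)

lemma auto_Bij: "\<alpha> \<in> auto G \<Longrightarrow> \<alpha> \<in> Bij (carrier G)"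
  by (simp add: auto_def)

lemma auto_iff:
  "\<alpha> \<in> auto G \<longleftrightarrow> \<alpha> \<in> Bij (carrier G) \<and>
    (\<forall>x\<in>carrier G. \<forall>y\<in>carrier G. \<alpha> (x \<otimes> y) = \<alpha> x \<otimes> \<alpha> y)"
  by (auto simp: auto_def hom_def dest: Bij_imp_funcset)

lemma inversion_anti_auto: "inversion G \<in> anti_auto G"
proof -
  have "bij_betw (inversion G) (carrier G) (carrier G)"
    by (rule bij_betw_byWitness[where f' = "inversion G"]) (auto simp: inversion_def)
  then show ?thesis
    by (simp add: anti_auto_def Bij_def inversion_def inv_mult_group)
qed

lemma inversion_square: "compose (carrier G) (inversion G) (inversion G) = (\<lambda>x\<in>carrier G. x)"
  by (auto simp: inversion_def compose_def fun_eq_iff)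

lemma auto_pm_Bij: "\<alpha> \<in> auto_pm G \<Longrightarrow> \<alpha> \<in> Bij (carrier G)"
  by (auto simp: auto_pm_def anti_auto_Bij auto_Bij)

text \<open>Both kinds of maps are treated at once: only the images of 1 times 1 and of the inverse
  of x times x are needed, and in a group a right inverse is also a left inverse.\<close>

lemma auto_pm_inv:
  assumes "\<alpha> \<in> auto_pm G" "x \<in> carrier G"
  shows "\<alpha> (inv x) = inv (\<alpha> x)"
proof -
  have mem: "\<alpha> y \<in> carrier G" if "y \<in> carrier G" for y
    using Bij_imp_funcset[OF auto_pm_Bij[OF assms(1)]] that by auto
  have mult: "\<alpha> (y \<otimes> z) = \<alpha> y \<otimes> \<alpha> z \<or> \<alpha> (y \<otimes> z) = \<alpha> z \<otimes> \<alpha> y"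
    if "y \<in> carrier G" "z \<in> carrier G" for y z
    using assms(1) that by (auto simp: auto_pm_def auto_iff anti_auto_def)
  have "\<alpha> \<one> = \<one>"
    using mult[of \<one> \<one>] mem[of \<one>] by (simp add: l_cancel_one')
  then have "\<alpha> (inv x) \<otimes> \<alpha> x = \<one>"
    using mult[of "inv x" x] mem assms(2) inv_comm[of "\<alpha> x" "\<alpha> (inv x)"] by auto
  then show ?thesis
    using inv_equality mem assms(2) by simp
qed

lemma compose_inversion_commute:
  assumes "\<alpha> \<in> auto_pm G"
  shows "compose (carrier G) \<alpha> (inversion G) = compose (carrier G) (inversion G) \<alpha>"
  using auto_pm_inv[OF assms] Bij_imp_funcset[OF auto_pm_Bij[OF assms]]
  by (auto simp: compose_def inversion_def fun_eq_iff)

lemma compose_inversion_anti_auto: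
  assumes "\<alpha> \<in> auto G"
  shows "compose (carrier G) (inversion G) \<alpha> \<in> anti_auto G"
proof -
  have "\<alpha> x \<in> carrier G" if "x \<in> carrier G" for x
    using funcset_mem[OF Bij_imp_funcset[OF auto_Bij[OF assms]] that] .
  then show ?thesis
    using assms compose_Bij[OF anti_auto_Bij[OF inversion_anti_auto] auto_Bij[OF assms]]
    by (simp add: anti_auto_def auto_iff compose_eq inversion_def inv_mult_group)
qed

lemma compose_inversion_auto:
  assumes "\<alpha> \<in> anti_auto G"
  shows "compose (carrier G) (inversion G) \<alpha> \<in> auto G"
proof -
  have "\<alpha> x \<in> carrier G" if "x \<in> carrier G" for x
    using funcset_mem[OF Bij_imp_funcset[OF anti_auto_Bij[OF assms]] that] .
  then show ?thesis
    using assms compose_Bij[OF anti_auto_Bij[OF inversion_anti_auto] anti_auto_Bij[OF assms]]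
    by (simp add: anti_auto_def auto_iff compose_eq inversion_def inv_mult_group)
qed

lemma compose_inversion_cancel:
  assumes "\<alpha> \<in> Bij (carrier G)"
  shows "compose (carrier G) (inversion G) (compose (carrier G) (inversion G) \<alpha>) = \<alpha>"
  using compose_assoc[of \<alpha> "carrier G" "carrier G" "inversion G" "inversion G"] assms
    inversion_square anti_auto_Bij[OF inversion_anti_auto]
  by (simp add: Bij_imp_funcset Bij_imp_extensional)

text \<open>Composing an anti-automorphism with \<iota> reverses products twice and gives an
  automorphism; composing with \<iota> again restores the original map.\<close>

lemma auto_pm_eq: "auto_pm G = auto G \<union> compose (carrier G) (inversion G) ` auto G"
proof
  show "auto_pm G \<subseteq> auto G \<union> compose (carrier G) (inversion G) ` auto G"
  proof
    fix \<alpha> assume "\<alpha> \<in> auto_pm G"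
    then show "\<alpha> \<in> auto G \<union> compose (carrier G) (inversion G) ` auto G"
      unfolding auto_pm_def
      using image_eqI[where x = "compose (carrier G) (inversion G) \<alpha>", OF _ compose_inversion_auto]
        compose_inversion_cancel[OF anti_auto_Bij] by (metis Un_iff)
  qed
  show "auto G \<union> compose (carrier G) (inversion G) ` auto G \<subseteq> auto_pm G"
    using compose_inversion_anti_auto by (auto simp: auto_pm_def)
qed

section \<open>The group of automorphisms and anti-automorphisms\<close>

lemma inversion_auto_pm: "inversion G \<in> auto_pm G"
  using inversion_anti_auto by (simp add: auto_pm_def)

lemma compose_auto_pm:
  assumes "\<alpha> \<in> auto_pm G" "\<beta> \<in> auto_pm G"
  shows "compose (carrier G) \<alpha> \<beta> \<in> auto_pm G"
proof -
  have "\<beta> y \<in> carrier G" if "y \<in> carrier G" for y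
    using funcset_mem[OF Bij_imp_funcset[OF auto_pm_Bij[OF assms(2)]] that] .
  then show ?thesis
    using assms compose_Bij[OF auto_pm_Bij[OF assms(1)] auto_pm_Bij[OF assms(2)]]
    by (auto simp: auto_pm_def anti_auto_def auto_iff compose_eq)
qed

text \<open>For inverses, an element outside \<open>auto G\<close> is written as \<iota> times an
  automorphism; \<iota> is its own inverse.\<close>

lemma subgroup_auto_pm: "subgroup (auto_pm G) (BijGroup (carrier G))"
proof (rule subgroup.intro)
  interpret B: group "BijGroup (carrier G)" by (rule group_BijGroup)
  show "auto_pm G \<subseteq> carrier (BijGroup (carrier G))"
    using auto_pm_Bij by (auto simp: BijGroup_def)
  show "\<one>\<^bsub>BijGroup (carrier G)\<^esub> \<in> auto_pm G"
    using id_in_auto by (simp add: BijGroup_def auto_pm_def)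
  show mult: "\<alpha> \<otimes>\<^bsub>BijGroup (carrier G)\<^esub> \<beta> \<in> auto_pm G" if "\<alpha> \<in> auto_pm G" "\<beta> \<in> auto_pm G" for \<alpha> \<beta>
    using that compose_auto_pm auto_pm_Bij by (auto simp: BijGroup_def)
  have auto_inv: "inv\<^bsub>BijGroup (carrier G)\<^esub> \<beta> \<in> auto_pm G" if "\<beta> \<in> auto G" for \<beta>
    using subgroup.m_inv_closed[OF subgroup_auto that] by (simp add: auto_pm_def)
  fix \<alpha> assume "\<alpha> \<in> auto_pm G"
  then consider "\<alpha> \<in> auto G" |
    \<beta> where "\<beta> \<in> auto G" "\<alpha> = compose (carrier G) (inversion G) \<beta>"
    by (auto simp: auto_pm_eq)
  then show "inv\<^bsub>BijGroup (carrier G)\<^esub> \<alpha> \<in> auto_pm G"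
  proof cases
    case 1
    then show ?thesis by (rule auto_inv)
  next
    case 2
    have Bij: "inversion G \<in> carrier (BijGroup (carrier G))" "\<beta> \<in> carrier (BijGroup (carrier G))"
      using auto_Bij[OF 2(1)] auto_pm_Bij[OF inversion_auto_pm] by (simp_all add: BijGroup_def)
    have "inv\<^bsub>BijGroup (carrier G)\<^esub> (inversion G) = inversion G"
      using Bij inversion_square by (intro B.inv_equality) (auto simp: BijGroup_def)
    moreover have "\<alpha> = inversion G \<otimes>\<^bsub>BijGroup (carrier G)\<^esub> \<beta>"
      using 2(2) Bij by (simp add: BijGroup_def)
    ultimately show ?thesis
      using B.inv_mult_group[OF Bij] mult[OF auto_inv[OF 2(1)] inversion_auto_pm] by simp
  qed
qed

lemma AutoPMGroup: "group (AutoPMGroup G)"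
  by (simp add: AutoPMGroup_def subgroup.subgroup_is_group subgroup_auto_pm group_BijGroup)

lemma carrier_AutoPMGroup [simp]: "carrier (AutoPMGroup G) = auto_pm G"
  by (simp add: AutoPMGroup_def)

lemma one_AutoPMGroup: "\<one>\<^bsub>AutoPMGroup G\<^esub> = (\<lambda>x\<in>carrier G. x)"
  by (simp add: AutoPMGroup_def BijGroup_def)

lemma mult_AutoPMGroup:
  "\<alpha> \<in> auto_pm G \<Longrightarrow> \<beta> \<in> auto_pm G \<Longrightarrow> \<alpha> \<otimes>\<^bsub>AutoPMGroup G\<^esub> \<beta> = compose (carrier G) \<alpha> \<beta>"
  using auto_pm_Bij by (simp add: AutoPMGroup_def BijGroup_def)

lemma inversion_square_AutoPMGroup:
  "inversion G \<otimes>\<^bsub>AutoPMGroup G\<^esub> inversion G = \<one>\<^bsub>AutoPMGroup G\<^esub>"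
  using inversion_auto_pm by (simp add: mult_AutoPMGroup inversion_square one_AutoPMGroup)

lemma inversion_central:
  "\<alpha> \<in> auto_pm G \<Longrightarrow>
    \<alpha> \<otimes>\<^bsub>AutoPMGroup G\<^esub> inversion G = inversion G \<otimes>\<^bsub>AutoPMGroup G\<^esub> \<alpha>"
  using inversion_auto_pm by (simp add: mult_AutoPMGroup compose_inversion_commute)

lemma generate_inversion:
  "generate (AutoPMGroup G) {inversion G} = {\<one>\<^bsub>AutoPMGroup G\<^esub>, inversion G}"
proof
  interpret P: group "AutoPMGroup G" by (rule AutoPMGroup)
  have inv: "inv\<^bsub>AutoPMGroup G\<^esub> (inversion G) = inversion G"
    using inversion_auto_pm inversion_square_AutoPMGroup by (intro P.inv_equality) auto
  have "f \<in> {\<one>\<^bsub>AutoPMGroup G\<^esub>, inversion G}"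
    if "f \<in> generate (AutoPMGroup G) {inversion G}" for f
    using that
  proof induction
    case (eng f g)
    then show ?case
      using inversion_auto_pm inversion_square_AutoPMGroup P.l_one[of "inversion G"]
        P.r_one[of "inversion G"] P.l_one[OF P.one_closed] by auto
  qed (auto simp: inv)
  then show "generate (AutoPMGroup G) {inversion G} \<subseteq> {\<one>\<^bsub>AutoPMGroup G\<^esub>, inversion G}"
    by blast
qed (auto intro: generate.one generate.incl)

lemma subgroup_auto_AutoPMGroup: "subgroup (auto G) (AutoPMGroup G)"
  unfolding AutoPMGroup_def
  by (rule group.subgroup_incl[OF group_BijGroup subgroup_auto subgroup_auto_pm])
    (auto simp: auto_pm_def)

text \<open>Conjugation by \<iota> times an automorphism is conjugation by the automorphism alone,
  because \<iota> is central.\<close>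

lemma auto_normal_AutoPMGroup: "auto G \<lhd> AutoPMGroup G"
proof -
  interpret P: group "AutoPMGroup G" by (rule AutoPMGroup)
  let ?P = "AutoPMGroup G" and ?i = "inversion G"
  interpret A: subgroup "auto G" ?P by (rule subgroup_auto_AutoPMGroup)
  show ?thesis
  proof (rule P.normal_invI[OF subgroup_auto_AutoPMGroup])
    fix \<alpha> \<phi> assume \<alpha>: "\<alpha> \<in> carrier ?P" and \<phi>: "\<phi> \<in> auto G"
    have iP: "?i \<in> carrier ?P" using inversion_auto_pm by simp
    from \<alpha> consider "\<alpha> \<in> auto G" | \<beta> where "\<beta> \<in> auto G" "\<alpha> = ?i \<otimes>\<^bsub>?P\<^esub> \<beta>"
      using mult_AutoPMGroup[OF inversion_auto_pm] by (auto simp: auto_pm_eq)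
    then show "\<alpha> \<otimes>\<^bsub>?P\<^esub> \<phi> \<otimes>\<^bsub>?P\<^esub> inv\<^bsub>?P\<^esub> \<alpha> \<in> auto G"
    proof cases
      case 1
      then show ?thesis using \<phi> by simp
    next
      case 2
      define \<theta> where "\<theta> = \<beta> \<otimes>\<^bsub>?P\<^esub> \<phi> \<otimes>\<^bsub>?P\<^esub> inv\<^bsub>?P\<^esub> \<beta>"
      have \<theta>: "\<theta> \<in> auto G" using 2(1) \<phi> by (simp add: \<theta>_def)
      have "\<alpha> \<otimes>\<^bsub>?P\<^esub> \<phi> \<otimes>\<^bsub>?P\<^esub> inv\<^bsub>?P\<^esub> \<alpha> = ?i \<otimes>\<^bsub>?P\<^esub> \<theta> \<otimes>\<^bsub>?P\<^esub> inv\<^bsub>?P\<^esub> ?i"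
        using 2 iP A.mem_carrier[OF 2(1)] A.mem_carrier[OF \<phi>]
        by (simp add: \<theta>_def P.inv_mult_group P.m_assoc del: carrier_AutoPMGroup)
      also have "\<dots> = \<theta>"
        using inversion_central[of \<theta>] iP A.mem_carrier[OF \<theta>]
        by (metis P.inv_solve_right P.m_closed carrier_AutoPMGroup)
      finally show ?thesis using \<theta> by simp
    qed
  qed
qed

text \<open>A map of both kinds would take the same value at the two products, against
  injectivity.\<close>

lemma auto_Int_anti_auto_empty:
  assumes "x \<in> carrier G" "y \<in> carrier G" "x \<otimes> y \<noteq> y \<otimes> x"
  shows "auto G \<inter> anti_auto G = {}"
proof (rule ccontr)
  assume "\<not> ?thesis"
  then obtain \<alpha> where \<alpha>: "\<alpha> \<in> auto G" "\<alpha> \<in> anti_auto G" by blast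
  then have "\<alpha> (x \<otimes> y) = \<alpha> (y \<otimes> x)"
    using assms by (simp add: auto_iff anti_auto_def)
  then show False
    using assms auto_Bij[OF \<alpha>(1)] by (auto simp: Bij_def bij_betw_def dest: inj_onD)
qed

text \<open>The first factor consists of the identity and the central element \<iota>, which the
  assumption keeps out of \<open>auto G\<close>. That the factors exhaust the group is
  \<open>auto_pm_eq\<close>.\<close>

lemma internal_direct_product_AutoPMGroup:
  assumes "auto G \<inter> anti_auto G = {}"
  shows "internal_direct_product (AutoPMGroup G)
    (generate (AutoPMGroup G) {inversion G}) (auto G)"
  unfolding internal_direct_product_def
proof (intro conjI)
  let ?P = "AutoPMGroup G" and ?i = "inversion G"
  interpret P: group ?P by (rule AutoPMGroup)
  have iP: "?i \<in> carrier ?P" using inversion_auto_pm by simp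
  show "auto G \<lhd> ?P" by (rule auto_normal_AutoPMGroup)
  show "generate ?P {?i} \<lhd> ?P"
  proof (rule P.normal_generateI)
    fix h g assume "h \<in> {?i}" "g \<in> carrier ?P"
    then show "g \<otimes>\<^bsub>?P\<^esub> h \<otimes>\<^bsub>?P\<^esub> inv\<^bsub>?P\<^esub> g \<in> {?i}"
      using inversion_central[of g] iP
      by (metis P.inv_solve_right P.m_closed carrier_AutoPMGroup singletonD singletonI)
  qed (use iP in simp)
  have "?i \<notin> auto G" using assms inversion_anti_auto by blast
  then show "generate ?P {?i} \<inter> auto G = {\<one>\<^bsub>?P\<^esub>}"
    using subgroup.one_closed[OF subgroup_auto_AutoPMGroup] by (auto simp: generate_inversion)
  have "\<one>\<^bsub>?P\<^esub> \<otimes>\<^bsub>?P\<^esub> \<phi> = \<phi>" if "\<phi> \<in> auto G" for \<phi>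
    using P.l_one subgroup.mem_carrier[OF subgroup_auto_AutoPMGroup that] .
  then have "generate ?P {?i} <#>\<^bsub>?P\<^esub> auto G = auto G \<union> (\<lambda>\<phi>. ?i \<otimes>\<^bsub>?P\<^esub> \<phi>) ` auto G"
    by (auto simp: generate_inversion set_mult_def)
  also have "\<dots> = auto_pm G"
    using mult_AutoPMGroup[OF inversion_auto_pm] by (auto simp: auto_pm_eq)
  finally show "generate ?P {?i} <#>\<^bsub>?P\<^esub> auto G = carrier ?P" by simp
qed

lemma involution_group_eq_auto_pm:
  assumes disj: "auto G \<inter> anti_auto G = {}" and gen: "square_id_auto_group G = auto G"
  shows "involution_group G = auto_pm G"
proof
  let ?P = "AutoPMGroup G" and ?i = "inversion G" and ?I = "involution_group G"
  interpret P: group ?P by (rule AutoPMGroup)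
  have "involutions G \<subseteq> carrier ?P"
    by (auto simp: involutions_def auto_pm_def)
  then show "?I \<subseteq> auto_pm G"
    using P.generate_incl by (simp add: involution_group_def)
  have sub: "subgroup ?I ?P"
    unfolding involution_group_def by (rule P.generate_is_subgroup) fact
  \<comment> \<open>The identity is an automorphism, so by \<open>disj\<close> no anti-automorphism
    equals it, and the exclusion in \<open>involutions\<close> is satisfied.\<close>
  have invol: "\<alpha> \<in> ?I" if "\<alpha> \<in> anti_auto G" "compose (carrier G) \<alpha> \<alpha> = (\<lambda>x\<in>carrier G. x)" for \<alpha>
    using that disj id_in_auto by (auto simp: involution_group_def involutions_def intro: generate.incl)
  have iI: "?i \<in> ?I" by (rule invol[OF inversion_anti_auto inversion_square])
  have cancel: "\<alpha> \<in> ?I" if "compose (carrier G) ?i \<alpha> \<in> ?I" "\<alpha> \<in> auto_pm G" for \<alpha>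
    using subgroup.m_closed[OF sub iI that(1)] inversion_auto_pm that(2)
      compose_inversion_cancel[OF auto_pm_Bij[OF that(2)]]
    by (simp add: mult_AutoPMGroup compose_auto_pm)
  have "square_id_autos G \<subseteq> ?I"
  proof
    fix \<sigma> assume \<sigma>: "\<sigma> \<in> square_id_autos G"
    then have auto: "\<sigma> \<in> auto G" and square: "compose (carrier G) \<sigma> \<sigma> = (\<lambda>x\<in>carrier G. x)"
      by (auto simp: square_id_autos_def)
    then have pm: "\<sigma> \<in> carrier ?P" "?i \<in> carrier ?P"
      using inversion_auto_pm by (auto simp: auto_pm_def)
    have "\<sigma> \<otimes>\<^bsub>?P\<^esub> \<sigma> = \<one>\<^bsub>?P\<^esub>"
      using pm square by (simp add: mult_AutoPMGroup one_AutoPMGroup)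
    \<comment> \<open>Centrality of \<iota> splits this into the squares of \<iota> and
      \<sigma>.\<close>
    then have "(?i \<otimes>\<^bsub>?P\<^esub> \<sigma>) \<otimes>\<^bsub>?P\<^esub> (?i \<otimes>\<^bsub>?P\<^esub> \<sigma>) = \<one>\<^bsub>?P\<^esub>"
      using pm inversion_central[of \<sigma>] inversion_square_AutoPMGroup
      by (metis P.m_assoc P.m_closed P.r_one carrier_AutoPMGroup)
    then have "compose (carrier G) ?i \<sigma> \<in> ?I"
      using pm compose_inversion_anti_auto[OF auto] compose_auto_pm[of ?i \<sigma>]
      by (intro invol) (auto simp: mult_AutoPMGroup one_AutoPMGroup)
    then show "\<sigma> \<in> ?I" using cancel pm by simp
  qed
  then have "generate ?P (square_id_autos G) \<subseteq> ?I"
    by (rule P.generate_subgroup_incl[OF _ sub])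
  \<comment> \<open>Both groups are subgroups of the group of bijections, so generating in either
    gives the same set.\<close>
  moreover have "generate ?P (square_id_autos G) = square_id_auto_group G"
    unfolding square_id_auto_group_def AutoGroup_def AutoPMGroup_def
    using group.generate_consistent[OF group_BijGroup _ subgroup_auto, of "square_id_autos G"]
      group.generate_consistent[OF group_BijGroup _ subgroup_auto_pm, of "square_id_autos G"]
      square_id_autos_subset[of G]
    by (auto simp: auto_pm_def)
  ultimately have "auto G \<subseteq> ?I" using gen by simp
  moreover from this have "anti_auto G \<subseteq> ?I"
    using cancel compose_inversion_auto by (auto simp: auto_pm_def)
  ultimately show "auto_pm G \<subseteq> ?I" by (simp add: auto_pm_def)
qed

end

theorem mainTheorem5:
  fixes X :: "'a set"
  assumes "finite X" and "card X \<ge> 2"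
  shows "square_id_auto_group (FreeGroup X) = auto (FreeGroup X) \<and>
         involution_group (FreeGroup X) = auto_pm (FreeGroup X) \<and>
         internal_direct_product (AutoPMGroup (FreeGroup X))
           (generate (AutoPMGroup (FreeGroup X)) {inversion (FreeGroup X)})
           (auto (FreeGroup X))"
proof -
  interpret F: group "FreeGroup X" by (rule group_FreeGroup)
  \<comment> \<open>Two distinct generators do not commute, which separates automorphisms from
    anti-automorphisms.\<close>
  obtain x y where "x \<in> X" "y \<in> X" "x \<noteq> y"
    using assms(2) by (metis card_le_Suc0_iff_eq assms(1) not_less_eq_eq numeral_2_eq_2)
  then have "auto (FreeGroup X) \<inter> anti_auto (FreeGroup X) = {}"
    by (intro F.auto_Int_anti_auto_empty[of "[(False, x)]" "[(False, y)]"])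
      (auto simp: inv_letter_def)
  then show ?thesis
    using square_id_auto_group_FreeGroup[OF assms(1)] F.involution_group_eq_auto_pm
      F.internal_direct_product_AutoPMGroup by blast
qed

end
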